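(* For every $\varepsilon>0$, there is an MST-optimal instance of the Steiner Tree problem such that no merge plan based dual solution has value more than $\left(\frac{7}{12}+\varepsilon\right)\mathrm{TMST}$.
   Context: An instance $(G,c,R)$ of the Steiner Tree problem consists of a finite connected undirected graph $G=(V,E)$, positive edge costs $c\colon E\to\mathbb{R}_{>0}$, and a nonempty set $R\subseteq V$ of terminals. A Steiner tree is a tree in $G$ containing all terminals; $\mathrm{OPT}$ is the minimum cost of a Steiner tree. $\mathrm{dist}(x,y)$ is the shortest-path distance in $(G,c)$. $\mathrm{TMST}$ is the cost of a minimum spanning tree of the complete graph on $R$ with edge costs $\mathrm{dist}(x,y)$. The instance is MST-optimal if $\mathrm{TMST}=\mathrm{OPT}$. Dual solutions (of the Bidirected Cut Relaxation): let $\vec E$ contain both orientations of every edge of $G$, each with the cost of the undirected edge, let $r\in R$ be an arbitrarily chosen root, and let $\delta^+(S)=\{(v,w)\in\vec E:v\in S,w\notin S\}$. A dual solution is a vector $y=(y_S)_{S\subseteq V}\ge 0$ with $\sum_{S:e\in\delta^+(S)}y_S\le c(e)$ for all $e\in\vec E$; its value is $\sum_{S\subseteq V\setminus\{r\},\,S\cap R\ne\emptyset}y_S$. A merge plan is a family $\mathcal{M}=(\mathcal{S}^t)_{t\ge 0}$ of partitions of $R$ such that for every two distinct terminals $x,y\in R$ there is a time $\mathrm{merge}_{\mathcal M}(x,y)\ge 0$ such that $x,y$ are in different parts of $\mathcal{S}^t$ if and only if $0\le t\le \mathrm{merge}_{\mathcal M}(x,y)$. Moat growing with merge plan $\mathcal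 M$ (applied to the bidirected graph $(V,\vec E)$): start at time $t=0$ with $y=0$. An edge $e\in\vec E$ is tight if $\sum_{U:e\in\delta^+(U)}y_U=c(e)$. As long as the current partition has more than one part: for every part $S$ of the current partition let $U_S$ be the set of vertices reachable from $S$ by a path of currently tight edges (including the vertices of $S$); increase the time $t$ at unit rate and simultaneously, for each part $S$, increase $y_{U_S}$ at unit rate (if several parts have the same set $U$, then $y_U$ grows at rate equal to the number of these parts), until the partition $\mathcal{S}^t$ changes or a new edge becomes tight; then repeat. (On a growth interval $(t_1,t_2]$ the relevant partition is the one equal to $\mathcal S^t$ for all $t\in(t_1,t_2]$.) When the partition consists of one part, output $y$. A dual solution $y$ is merge plan based if there is a merge plan $\mathcal M$ for which this procedure, applied to the instance and $\mathcal M$, outputs $y$. *)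

theory Defs
  imports Complex_Main "HOL-Library.Disjoint_Sets"
begin

section \<open>Undirected graphs\<close>

text \<open>
  Undirected edges are two-element vertex sets.  The AFP entry Graph-Theory models undirected graphs
  as symmetric digraphs, for which its notions of cycle and tree are not the undirected ones
  (the closed walk a, b, a counts as a cycle), hence the definitions below.
\<close>

definition simple_graph :: "'a set \<Rightarrow> 'a set set \<Rightarrow> bool" where
  "simple_graph V E \<longleftrightarrow> finite V \<and> (\<forall>e\<in>E. e \<subseteq> V \<and> card e = 2)"

definition path :: "'a set \<Rightarrow> 'a set set \<Rightarrow> 'a list \<Rightarrow> bool" where
  "path V E p \<longleftrightarrow> p \<noteq> [] \<and> set p \<subseteq> V \<and> distinct p \<and> successively (\<lambda>u v. {u, v} \<in> E) p"

definition paths_between :: "'a set \<Rightarrow> 'a set set \<Rightarrow> 'a \<Rightarrow> 'a \<Rightarrow> 'a list set" where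
  "paths_between V E x y = {p. path V E p \<and> hd p = x \<and> last p = y}"

definition graph_connected :: "'a set \<Rightarrow> 'a set set \<Rightarrow> bool" where
  "graph_connected V E \<longleftrightarrow> V \<noteq> {} \<and> (\<forall>x\<in>V. \<forall>y\<in>V. paths_between V E x y \<noteq> {})"

definition cycle :: "'a set \<Rightarrow> 'a set set \<Rightarrow> 'a list \<Rightarrow> bool" where
  "cycle V E p \<longleftrightarrow> path V E p \<and> 3 \<le> length p \<and> {last p, hd p} \<in> E"

definition tree :: "'a set \<Rightarrow> 'a set set \<Rightarrow> bool" where
  "tree V E \<longleftrightarrow> simple_graph V E \<and> graph_connected V E \<and> (\<nexists>p. cycle V E p)"


section \<open>The Steiner tree problem\<close>

definition steiner_instance :: "'a set \<Rightarrow> 'a set set \<Rightarrow> ('a set \<Rightarrow> real) \<Rightarrow> 'a set \<Rightarrow> bool" where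
  "steiner_instance V E c R \<longleftrightarrow>
     simple_graph V E \<and> graph_connected V E \<and> (\<forall>e\<in>E. 0 < c e) \<and> R \<subseteq> V \<and> R \<noteq> {}"

definition steiner_tree :: "'a set \<Rightarrow> 'a set set \<Rightarrow> 'a set \<Rightarrow> 'a set \<Rightarrow> 'a set set \<Rightarrow> bool" where
  "steiner_tree V E R W F \<longleftrightarrow> W \<subseteq> V \<and> F \<subseteq> E \<and> tree W F \<and> R \<subseteq> W"

definition OPT :: "'a set \<Rightarrow> 'a set set \<Rightarrow> ('a set \<Rightarrow> real) \<Rightarrow> 'a set \<Rightarrow> real" where
  "OPT V E c R = Min {sum c F | W F. steiner_tree V E R W F}"

definition path_cost :: "('a set \<Rightarrow> real) \<Rightarrow> 'a list \<Rightarrow> real" where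
  "path_cost c p = (\<Sum>(u, v)\<leftarrow>zip p (tl p). c {u, v})"

definition sp_dist :: "'a set \<Rightarrow> 'a set set \<Rightarrow> ('a set \<Rightarrow> real) \<Rightarrow> 'a \<Rightarrow> 'a \<Rightarrow> real" where
  "sp_dist V E c x y = Min (path_cost c ` paths_between V E x y)"

definition complete_edges :: "'a set \<Rightarrow> 'a set set" where
  "complete_edges R = {{x, y} | x y. x \<in> R \<and> y \<in> R \<and> x \<noteq> y}"

text \<open>
  The cost of the edge {x, y} of the complete graph is the distance of x and y; the
  description is unique because the distance is symmetric, see closure_cost_doubleton.
\<close>

definition closure_cost :: "'a set \<Rightarrow> 'a set set \<Rightarrow> ('a set \<Rightarrow> real) \<Rightarrow> 'a set \<Rightarrow> real" where
  "closure_cost V E c e = (THE d. \<exists>x y. e = {x, y} \<and> d = sp_dist V E c x y)"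

definition mst_cost :: "'a set \<Rightarrow> 'a set set \<Rightarrow> ('a set \<Rightarrow> real) \<Rightarrow> real" where
  "mst_cost V E c = Min {sum c F | F. F \<subseteq> E \<and> tree V F}"

definition TMST :: "'a set \<Rightarrow> 'a set set \<Rightarrow> ('a set \<Rightarrow> real) \<Rightarrow> 'a set \<Rightarrow> real" where
  "TMST V E c R = mst_cost R (complete_edges R) (closure_cost V E c)"

definition mst_optimal :: "'a set \<Rightarrow> 'a set set \<Rightarrow> ('a set \<Rightarrow> real) \<Rightarrow> 'a set \<Rightarrow> bool" where
  "mst_optimal V E c R \<longleftrightarrow> TMST V E c R = OPT V E c R"

lemma path_rev: "path V E (rev p) \<longleftrightarrow> path V E p"
  by (simp add: path_def successively_rev insert_commute)

lemma path_cost_append: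
  "path_cost c (p @ [x, y]) = path_cost c (p @ [x]) + c {x, y}"
  by (induction p rule: induct_list012) (auto simp: path_cost_def)

lemma path_cost_rev: "path_cost c (rev p) = path_cost c p"
proof (induction p rule: induct_list012)
  case (3 x y zs)
  then show ?case
    using path_cost_append[of c "rev zs" y x] by (simp add: path_cost_def insert_commute)
qed (auto simp: path_cost_def)

lemma sp_dist_commute: "sp_dist V E c x y = sp_dist V E c y x"
proof -
  have sub: "path_cost c ` paths_between V E x y \<subseteq> path_cost c ` paths_between V E y x" for x y
  proof
    fix d assume "d \<in> path_cost c ` paths_between V E x y"
    then obtain p where p: "path V E p" "hd p = x" "last p = y" "d = path_cost c p"
      by (auto simp: paths_between_def)
    then have "rev p \<in> paths_between V E y x"
      by (auto simp: paths_between_def path_rev hd_rev last_rev)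
    then show "d \<in> path_cost c ` paths_between V E y x"
      using p(4) path_cost_rev[of c p] by (metis image_eqI)
  qed
  show ?thesis
    unfolding sp_dist_def using sub[of x y] sub[of y x] by (metis subset_antisym)
qed

lemma closure_cost_doubleton: "closure_cost V E c {x, y} = sp_dist V E c x y"
  unfolding closure_cost_def
  by (rule the_equality) (auto simp: doubleton_eq_iff sp_dist_commute)


section \<open>Dual solutions of the bidirected cut relaxation\<close>

definition arcs :: "'a set set \<Rightarrow> ('a \<times> 'a) set" where
  "arcs E = {(u, v). {u, v} \<in> E}"

definition delta_out :: "'a set set \<Rightarrow> 'a set \<Rightarrow> ('a \<times> 'a) set" where
  "delta_out E S = {(v, w). (v, w) \<in> arcs E \<and> v \<in> S \<and> w \<notin> S}"

definition load :: "'a set \<Rightarrow> 'a set set \<Rightarrow> ('a set \<Rightarrow> real) \<Rightarrow> 'a \<times> 'a \<Rightarrow> real" where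
  "load V E y a = (\<Sum>S | S \<subseteq> V \<and> a \<in> delta_out E S. y S)"

definition dual_solution :: "'a set \<Rightarrow> 'a set set \<Rightarrow> ('a set \<Rightarrow> real) \<Rightarrow> ('a set \<Rightarrow> real) \<Rightarrow> bool" where
  "dual_solution V E c y \<longleftrightarrow>
     (\<forall>S. S \<subseteq> V \<longrightarrow> 0 \<le> y S) \<and> (\<forall>(u, v)\<in>arcs E. load V E y (u, v) \<le> c {u, v})"

definition dual_value :: "'a set \<Rightarrow> 'a set \<Rightarrow> 'a \<Rightarrow> ('a set \<Rightarrow> real) \<Rightarrow> real" where
  "dual_value V R r y = (\<Sum>S | S \<subseteq> V - {r} \<and> S \<inter> R \<noteq> {}. y S)"


section \<open>Merge plans and moat growing\<close>

definition merge_plan :: "'a set \<Rightarrow> (real \<Rightarrow> 'a set set) \<Rightarrow> bool" where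
  "merge_plan R M \<longleftrightarrow>
     (\<forall>t\<ge>0. partition_on R (M t)) \<and>
     (\<forall>x\<in>R. \<forall>y\<in>R. x \<noteq> y \<longrightarrow>
        (\<exists>m\<ge>0. \<forall>t\<ge>0. (\<nexists>S. S \<in> M t \<and> x \<in> S \<and> y \<in> S) \<longleftrightarrow> t \<le> m))"

definition tight_arcs ::
    "'a set \<Rightarrow> 'a set set \<Rightarrow> ('a set \<Rightarrow> real) \<Rightarrow> ('a set \<Rightarrow> real) \<Rightarrow> ('a \<times> 'a) set" where
  "tight_arcs V E c y = {(u, v). (u, v) \<in> arcs E \<and> load V E y (u, v) = c {u, v}}"

definition moat :: "'a set \<Rightarrow> 'a set set \<Rightarrow> ('a set \<Rightarrow> real) \<Rightarrow> ('a set \<Rightarrow> real) \<Rightarrow> 'a set \<Rightarrow> 'a set" where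
  "moat V E c y S = (tight_arcs V E c y)\<^sup>* `` S"

definition grow ::
    "'a set \<Rightarrow> 'a set set \<Rightarrow> ('a set \<Rightarrow> real) \<Rightarrow> 'a set set \<Rightarrow> real \<Rightarrow> ('a set \<Rightarrow> real) \<Rightarrow> ('a set \<Rightarrow> real)" where
  "grow V E c P d y = (\<lambda>U. y U + d * real (card {S \<in> P. moat V E c y S = U}))"

text \<open>
  A merge plan changes only immediately after a time (it is left-continuous), so the partition
  governing growth from time t on is the one valid on some interval (t, t'], not M t.
\<close>

definition current_partition :: "(real \<Rightarrow> 'a set set) \<Rightarrow> real \<Rightarrow> 'a set set \<Rightarrow> bool" where
  "current_partition M t P \<longleftrightarrow> (\<exists>t'>t. \<forall>s\<in>{t<..t'}. M s = P)"

text \<open>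
  moat_state V E c M t y: the procedure starts an iteration (or stops) at time t with
  the vector y.  In a step, t' is the first time after t at which the partition changes or an arc
  becomes tight that was not tight at time t.
\<close>

inductive moat_state ::
    "'a set \<Rightarrow> 'a set set \<Rightarrow> ('a set \<Rightarrow> real) \<Rightarrow> (real \<Rightarrow> 'a set set) \<Rightarrow> real \<Rightarrow> ('a set \<Rightarrow> real) \<Rightarrow> bool"
  for V E c M where
  start: "moat_state V E c M 0 (\<lambda>_. 0)"
| step: "moat_state V E c M t' (grow V E c P (t' - t) y)"
  if "moat_state V E c M t y"
    and "t < t'"
    and "\<forall>s\<in>{t<..t'}. M s = P"
    and "1 < card P"
    and "\<forall>s\<in>{t<..<t'}. tight_arcs V E c (grow V E c P (s - t) y) \<subseteq> tight_arcs V E c y"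
    and "\<not> current_partition M t' P \<or>
         \<not> tight_arcs V E c (grow V E c P (t' - t) y) \<subseteq> tight_arcs V E c y"

definition moat_growing_output ::
    "'a set \<Rightarrow> 'a set set \<Rightarrow> ('a set \<Rightarrow> real) \<Rightarrow> (real \<Rightarrow> 'a set set) \<Rightarrow> ('a set \<Rightarrow> real) \<Rightarrow> bool" where
  "moat_growing_output V E c M y \<longleftrightarrow>
     (\<exists>t P. moat_state V E c M t y \<and> current_partition M t P \<and> card P = 1)"

definition merge_plan_based ::
    "'a set \<Rightarrow> 'a set set \<Rightarrow> ('a set \<Rightarrow> real) \<Rightarrow> 'a set \<Rightarrow> ('a set \<Rightarrow> real) \<Rightarrow> bool" where
  "merge_plan_based V E c R y \<longleftrightarrow> (\<exists>M. merge_plan R M \<and> moat_growing_output V E c M y)"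

end

theory Submission
  imports Defs "HOL-Library.Countable"
begin

text \<open>
  Any two terminals are at distance 1.  In general a part needs time 1 to reach the terminals of
  another part; here this takes little more than time 7/12.  Consider a path whose vertices are,
  alternately, closer to and farther from a terminal b.  When another terminal x walks along it, the
  steps away from b have already been made tight by b and cost x no time; only the steps towards b
  do.  In this way x advances at speed 3 from time 1/2 on, and at time 7/12 it has got to distance
  3/4.  There the ends of many such paths of one terminal a are strung together by vertices that b
  reaches slightly earlier: b makes tight all arcs in one direction and a, right afterwards, all arcs
  in the other.  Hence at time 7/12 all terminals whose paths end there get together instantly,
  however far apart their ends are, and jointly they make an arc to b tight in almost no time.  With
  one such gadget for every list of K + 1 terminals, at most K parts are still apart from the root
  shortly after time 7/12, whatever the merge plan.

  A tree that joins b, a and x in a gadget costs at least 1/2 + 3/4 + 3/4 = 2, so that Steiner vertices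
  do not pay off.
\<close>


section \<open>Graphs and retractions\<close>

text \<open>The constant comes from certifying that Steiner vertices do not pay off. A gadget is
  retracted at random onto its terminals. Half of the probability goes to b, which forces the edges
  that lead from b or from an owner into a zigzag to cost at least 1/2. The other half has to pass
  from a to x along their two zigzags, at a total cost of at least 1/2. Divided evenly, each zigzag
  is 1/4 long; speed 3 covers this in time 1/12, and 1/2 + 1/12 = 7/12. The retraction also explains
  why a needs many zigzags: neighbouring ends on a string may differ by two units 1/(12 N) of
  probability only, but the ends range from no share of x, at the vertex common to all x, to equal
  shares of a and x. The obstacle is the merge plan. A part that already holds the head of an arc
  does not push it, so merging can leave arcs loose. Hence the upper bounds on loads are shown for
  every plan, and the stringing together is claimed only for terminals still apart from b; as parts
  only get coarser, these have been apart all along.\<close>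

lemma path_rtrancl_arcs:
  assumes "path V E p"
  shows "(hd p, last p) \<in> (arcs E)\<^sup>*"
proof -
  have "p \<noteq> [] \<Longrightarrow> successively (\<lambda>u v. {u, v} \<in> E) p \<Longrightarrow> (hd p, last p) \<in> (arcs E)\<^sup>*"
  proof (induction p rule: induct_list012)
    case (3 x y zs)
    then have "(x, y) \<in> arcs E" "(y, last (y # zs)) \<in> (arcs E)\<^sup>*"
      by (auto simp: arcs_def)
    then show ?case by (simp add: converse_rtrancl_into_rtrancl)
  qed auto
  then show ?thesis using assms by (auto simp: path_def)
qed

lemma connected_rtrancl_arcs:
  assumes "graph_connected V E" "x \<in> V" "y \<in> V"
  shows "(x, y) \<in> (arcs E)\<^sup>*"
proof -
  obtain p where "path V E p" "hd p = x" "last p = y"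
    using assms by (fastforce simp: graph_connected_def paths_between_def)
  then show ?thesis using path_rtrancl_arcs by metis
qed

lemma rtrancl_arcs_path:
  assumes "(x, y) \<in> (arcs E)\<^sup>*" "x \<in> V" "\<And>e. e \<in> E \<Longrightarrow> e \<subseteq> V"
  shows "paths_between V E x y \<noteq> {}"
  using assms(1)
proof (induction rule: rtrancl_induct)
  case base
  have "[x] \<in> paths_between V E x x"
    using assms(2) by (simp add: paths_between_def path_def)
  then show ?case by blast
next
  case (step y z)
  then obtain p where p: "path V E p" "hd p = x" "last p = y"
    by (auto simp: paths_between_def)
  have yz: "{y, z} \<in> E" using step.hyps by (simp add: arcs_def)
  show ?case
  proof (cases "z \<in> set p")
    case True
    then obtain xs ys where s: "p = xs @ z # ys" by (meson split_list)
    have "path V E (xs @ [z])"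
      using p(1) unfolding s path_def successively_append_iff by auto
    moreover have "hd (xs @ [z]) = x" using p(2) s by (cases xs) auto
    ultimately have "xs @ [z] \<in> paths_between V E x z"
      by (simp add: paths_between_def)
    then show ?thesis by blast
  next
    case False
    have "path V E (p @ [z])"
      using p yz assms(3)[OF yz] False unfolding path_def successively_append_iff by auto
    moreover have "hd (p @ [z]) = x" using p by (auto simp: path_def)
    ultimately have "p @ [z] \<in> paths_between V E x z"
      by (simp add: paths_between_def)
    then show ?thesis by blast
  qed
qed

text \<open>A vertex set grown along crossing edges gains with each new vertex an edge inside it
  that was not counted before. The formulation avoids trees, since the lemma is applied to images of
  graphs under a retraction as well.\<close>

lemma connected_card_le:
  assumes fin: "finite X" "finite G"
    and conn: "\<And>x y. x \<in> X \<Longrightarrow> y \<in> X \<Longrightarrow> (x, y) \<in> (arcs G)\<^sup>*"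
    and closed: "\<And>u v. {u, v} \<in> G \<Longrightarrow> u \<in> X \<Longrightarrow> v \<in> X"
  shows "card X \<le> Suc (card G)"
proof -
  have grow: "\<exists>A\<subseteq>X. card A = Suc k \<and> k \<le> card {e \<in> G. e \<subseteq> A}" if "Suc k \<le> card X" for k
    using that
  proof (induction k)
    case 0
    then obtain x where "x \<in> X" by fastforce
    then show ?case by (intro exI[of _ "{x}"]) auto
  next
    case (Suc k)
    then obtain A where A: "A \<subseteq> X" "card A = Suc k" "k \<le> card {e \<in> G. e \<subseteq> A}" by auto
    then obtain x where x: "x \<in> A" by fastforce
    have "A \<noteq> X" using A Suc.prems by auto
    then obtain y where y: "y \<in> X" "y \<notin> A" using A by auto
    have "\<exists>u v. u \<in> A \<and> v \<notin> A \<and> {u, v} \<in> G"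
    proof (rule ccontr)
      assume no: "\<not> ?thesis"
      have "(x, y) \<in> (arcs G)\<^sup>*" using conn A x y by auto
      then have "y \<in> A"
        by (induction rule: rtrancl_induct) (use x no in \<open>auto simp: arcs_def\<close>)
      then show False using y by simp
    qed
    then obtain u v where uv: "u \<in> A" "v \<notin> A" "{u, v} \<in> G" by blast
    have "insert {u, v} {e \<in> G. e \<subseteq> A} \<subseteq> {e \<in> G. e \<subseteq> insert v A}"
      using uv by auto
    then have "card (insert {u, v} {e \<in> G. e \<subseteq> A}) \<le> card {e \<in> G. e \<subseteq> insert v A}"
      using fin by (intro card_mono) auto
    moreover have "card (insert {u, v} {e \<in> G. e \<subseteq> A}) = Suc (card {e \<in> G. e \<subseteq> A})"
      using fin uv by (subst card_insert_disjoint) auto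
    moreover have "v \<in> X" using closed uv A by auto
    moreover have "card (insert v A) = Suc (Suc k)"
      using uv A fin finite_subset by (metis card_insert_disjoint)
    ultimately show ?case using A by (intro exI[of _ "insert v A"]) auto
  qed
  show ?thesis
  proof (cases "card X")
    case (Suc k)
    then obtain A where "A \<subseteq> X" "k \<le> card {e \<in> G. e \<subseteq> A}" using grow[of k] by auto
    moreover have "card {e \<in> G. e \<subseteq> A} \<le> card G" using fin by (intro card_mono) auto
    ultimately show ?thesis using Suc by simp
  qed simp
qed

section \<open>Stars: the spanning trees that attain the minimum\<close>

definition star_edges :: "'a \<Rightarrow> 'a set \<Rightarrow> 'a set set" where
  "star_edges x R = (\<lambda>y. {x, y}) ` (R - {x})"

lemma card_star_edges:
  assumes "finite R" "x \<in> R"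
  shows "card (star_edges x R) = card R - 1"
  unfolding star_edges_def using assms
  by (subst card_image) (auto simp: inj_on_def doubleton_eq_iff)

lemma tree_star_edges:
  assumes "finite R" "x \<in> R"
  shows "tree R (star_edges x R)"
proof -
  let ?F = "star_edges x R"
  have sg: "simple_graph R ?F"
    using assms by (auto simp: simple_graph_def star_edges_def card_insert_if)
  have "(x, y) \<in> (arcs ?F)\<^sup>* \<and> (y, x) \<in> (arcs ?F)\<^sup>*" if "y \<in> R" for y
    using that by (cases "y = x") (auto simp: arcs_def star_edges_def insert_commute intro!: r_into_rtrancl)
  then have "(y, z) \<in> (arcs ?F)\<^sup>*" if "y \<in> R" "z \<in> R" for y z
    using that by (meson rtrancl_trans)
  then have "graph_connected R ?F"
    unfolding graph_connected_def using assms sg rtrancl_arcs_path[of _ _ ?F R]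
    by (auto simp: simple_graph_def)
  moreover have "\<not> cycle R ?F p" for p
  proof
    assume c: "cycle R ?F p"
    then have "3 \<le> length p" by (simp add: cycle_def)
    then obtain u v w q where p: "p = u # v # w # q"
      by (metis One_nat_def Suc_1 Suc_le_length_iff numeral_3_eq_3)
    \<comment> \<open>These three edges of the cycle have no common vertex, whereas all edges of the
      star contain \<open>x\<close>.\<close>
    have "{u, v} \<in> ?F" "{v, w} \<in> ?F" "{last p, u} \<in> ?F" "distinct p"
      using c by (auto simp: cycle_def path_def p)
    moreover have "x \<in> e" if "e \<in> ?F" for e using that by (auto simp: star_edges_def)
    ultimately have "x \<in> {u, v}" "x \<in> {v, w}" "x \<in> {last p, u}" "distinct p" by auto
    moreover have "last p \<in> set (w # q)" by (simp add: p)
    ultimately show False using p by auto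
  qed
  ultimately show ?thesis using sg by (auto simp: tree_def)
qed

text \<open>
  A random retraction of the vertices onto the terminals that separates the ends of every edge with
  probability at most the cost of the edge certifies that Steiner vertices are of no use.
\<close>

locale retractable =
  fixes V :: "'a set" and E c R and \<Omega> :: "'w set" and \<phi> :: "'w \<Rightarrow> 'a \<Rightarrow> 'a"
  assumes inst: "steiner_instance V E c R"
    and unit: "\<And>x y. x \<in> R \<Longrightarrow> y \<in> R \<Longrightarrow> x \<noteq> y \<Longrightarrow> {x, y} \<in> E \<and> c {x, y} = 1"
    and fin: "finite \<Omega>" "\<Omega> \<noteq> {}"
    and fix_R: "\<And>\<omega> x. \<omega> \<in> \<Omega> \<Longrightarrow> x \<in> R \<Longrightarrow> \<phi> \<omega> x = x"
    and into_R: "\<And>\<omega> v. \<omega> \<in> \<Omega> \<Longrightarrow> v \<in> V \<Longrightarrow> \<phi> \<omega> v \<in> R"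
    and separate: "\<And>u v. {u, v} \<in> E \<Longrightarrow>
      real (card {\<omega> \<in> \<Omega>. \<phi> \<omega> u \<noteq> \<phi> \<omega> v}) \<le> real (card \<Omega>) * c {u, v}"
begin

lemma finite_V: "finite V" and edge_sub: "e \<in> E \<Longrightarrow> e \<subseteq> V" and edge_card: "e \<in> E \<Longrightarrow> card e = 2"
  and R_sub: "R \<subseteq> V" and R_ne: "R \<noteq> {}" and c_pos: "e \<in> E \<Longrightarrow> 0 < c e"
  using inst by (auto simp: steiner_instance_def simple_graph_def)

lemma finite_R: "finite R" and finite_E: "finite E"
  using finite_V R_sub edge_sub by (auto intro: finite_subset finite_subset[of E "Pow V"])

lemma card_Omega_pos: "0 < real (card \<Omega>)"
  using fin by (simp add: card_gt_0_iff)

text \<open>Under each outcome the image of \<open>F\<close> connects \<open>R\<close>, so at least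
  \<open>card R - 1\<close> edges of \<open>F\<close> have their ends separated. Averaging over the
  outcomes gives the bound, because \<open>c e\<close> is at least the fraction of outcomes that
  separate the ends of \<open>e\<close>.\<close>

lemma connected_cost_ge:
  assumes W: "W \<subseteq> V" "R \<subseteq> W" and F: "F \<subseteq> E" "\<And>e. e \<in> F \<Longrightarrow> e \<subseteq> W"
    and conn: "graph_connected W F"
  shows "real (card R) - 1 \<le> sum c F"
proof -
  define cut where "cut \<omega> e \<longleftrightarrow> card (\<phi> \<omega> ` e) \<noteq> 1" for \<omega> and e :: "'a set"
  have cut_iff: "cut \<omega> {u, v} \<longleftrightarrow> \<phi> \<omega> u \<noteq> \<phi> \<omega> v" for \<omega> u v
    by (simp add: cut_def card_insert_if)
  have finF: "finite F" using F finite_E finite_subset by blast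
  have one: "card R \<le> Suc (card {e \<in> F. cut \<omega> e})" if "\<omega> \<in> \<Omega>" for \<omega>
  proof -
    \<comment> \<open>Edges whose ends have the same image are dropped; walks in the image simply
      stand still there.\<close>
    let ?G = "image (\<phi> \<omega>) ` {e \<in> F. cut \<omega> e}"
    have "card R \<le> Suc (card ?G)"
    proof (rule connected_card_le)
      fix x y assume xy: "x \<in> R" "y \<in> R"
      have "(x, y) \<in> (arcs F)\<^sup>*" using connected_rtrancl_arcs[OF conn] xy W by auto
      then have "(\<phi> \<omega> x, \<phi> \<omega> y) \<in> (arcs ?G)\<^sup>*"
      proof (induction rule: rtrancl_induct)
        case (step y z)
        then have "{y, z} \<in> F" by (simp add: arcs_def)
        show ?case
        proof (cases "\<phi> \<omega> y = \<phi> \<omega> z")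
          case False
          then have "{\<phi> \<omega> y, \<phi> \<omega> z} \<in> ?G"
            using \<open>{y, z} \<in> F\<close> by (auto simp: cut_iff intro!: image_eqI[of _ _ "{y, z}"])
          then have "(\<phi> \<omega> y, \<phi> \<omega> z) \<in> arcs ?G" by (simp add: arcs_def)
          then show ?thesis using step.IH by (rule rtrancl_into_rtrancl[rotated])
        qed (use step.IH in simp)
      qed simp
      then show "(x, y) \<in> (arcs ?G)\<^sup>*" using fix_R that xy by simp
    next
      fix u v assume "{u, v} \<in> ?G"
      then obtain e where "e \<in> F" "{u, v} = \<phi> \<omega> ` e" by auto
      then have "v \<in> \<phi> \<omega> ` e" "e \<subseteq> V" using F edge_sub by blast+
      then show "v \<in> R" using into_R that by blast
    qed (use finite_R finF in auto)
    also have "card ?G \<le> card {e \<in> F. cut \<omega> e}" by (rule card_image_le) (use finF in auto)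
    finally show ?thesis by simp
  qed
  have "real (card \<Omega>) * (real (card R) - 1) = (\<Sum>\<omega>\<in>\<Omega>. real (card R) - 1)" by simp
  also have "\<dots> \<le> (\<Sum>\<omega>\<in>\<Omega>. real (card {e \<in> F. cut \<omega> e}))"
    using one by (intro sum_mono) force
  also have "\<dots> = (\<Sum>\<omega>\<in>\<Omega>. \<Sum>e\<in>F. of_bool (cut \<omega> e))"
    using finF by (simp add: Int_def)
  also have "\<dots> = (\<Sum>e\<in>F. \<Sum>\<omega>\<in>\<Omega>. of_bool (cut \<omega> e))" by (rule sum.swap)
  also have "\<dots> = (\<Sum>e\<in>F. real (card {\<omega> \<in> \<Omega>. cut \<omega> e}))"
    using fin by (simp add: Int_def)
  also have "\<dots> \<le> (\<Sum>e\<in>F. real (card \<Omega>) * c e)"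
  proof (rule sum_mono)
    fix e assume e: "e \<in> F"
    then obtain u v where "e = {u, v}" using F edge_card by (metis card_2_iff subsetD)
    then show "real (card {\<omega> \<in> \<Omega>. cut \<omega> e}) \<le> real (card \<Omega>) * c e"
      using separate[of u v] e F cut_iff by auto
  qed
  also have "\<dots> = real (card \<Omega>) * sum c F" by (simp add: sum_distrib_left)
  finally show ?thesis using card_Omega_pos by simp
qed

text \<open>The fraction of outcomes that separate two vertices obeys the triangle inequality, so it
  is at most the cost of any path between them. For distinct terminals it is 1, since every
  retraction fixes both.\<close>

lemma path_cost_ge:
  assumes "x \<in> R" "y \<in> R" "x \<noteq> y" "p \<in> paths_between V E x y"
  shows "1 \<le> path_cost c p"
proof -
  have "p \<noteq> [] \<Longrightarrow> successively (\<lambda>u v. {u, v} \<in> E) p \<Longrightarrow>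
      real (card {\<omega> \<in> \<Omega>. \<phi> \<omega> (hd p) \<noteq> \<phi> \<omega> (last p)}) \<le> real (card \<Omega>) * path_cost c p"
  proof (induction p rule: induct_list012)
    case (3 u v q)
    let ?B = "\<lambda>u w. {\<omega> \<in> \<Omega>. \<phi> \<omega> u \<noteq> \<phi> \<omega> w}"
    let ?w = "last (v # q)"
    have "card (?B u ?w) \<le> card (?B u v \<union> ?B v ?w)" using fin by (intro card_mono) auto
    also have "\<dots> \<le> card (?B u v) + card (?B v ?w)" by (rule card_Un_le)
    finally have "real (card (?B u ?w)) \<le> real (card (?B u v)) + real (card (?B v ?w))" by linarith
    moreover have "real (card (?B u v)) \<le> real (card \<Omega>) * c {u, v}" using 3 separate by simp
    moreover have "real (card (?B v ?w)) \<le> real (card \<Omega>) * path_cost c (v # q)" using 3 by simp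
    moreover have "path_cost c (u # v # q) = c {u, v} + path_cost c (v # q)"
      by (simp add: path_cost_def)
    ultimately show ?case by (simp add: algebra_simps)
  qed (auto simp: path_cost_def)
  moreover have "p \<noteq> []" "successively (\<lambda>u v. {u, v} \<in> E) p" "hd p = x" "last p = y"
    using assms by (auto simp: paths_between_def path_def)
  moreover have "{\<omega> \<in> \<Omega>. \<phi> \<omega> x \<noteq> \<phi> \<omega> y} = \<Omega>" using assms fix_R by auto
  ultimately have "real (card \<Omega>) * 1 \<le> real (card \<Omega>) * path_cost c p" by simp
  then show ?thesis using card_Omega_pos by simp
qed

lemma sp_dist_terminals:
  assumes "x \<in> R" "y \<in> R" "x \<noteq> y"
  shows "sp_dist V E c x y = 1"
  unfolding sp_dist_def
proof (rule Min_eqI)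
  have "paths_between V E x y \<subseteq> {p. set p \<subseteq> V \<and> length p \<le> card V}"
    using finite_V by (auto simp: paths_between_def path_def distinct_card[symmetric] intro: card_mono)
  then show "finite (path_cost c ` paths_between V E x y)"
    using finite_lists_length_le[OF finite_V] finite_subset by blast
  have "[x, y] \<in> paths_between V E x y"
    using assms unit[of x y] R_sub by (auto simp: paths_between_def path_def)
  moreover have "path_cost c [x, y] = 1" using unit[of x y] assms by (simp add: path_cost_def)
  ultimately show "1 \<in> path_cost c ` paths_between V E x y" by (metis image_eqI)
qed (use path_cost_ge assms in auto)

lemma closure_cost_terminals:
  assumes "e \<in> complete_edges R"
  shows "closure_cost V E c e = 1"
  using assms sp_dist_terminals by (auto simp: complete_edges_def closure_cost_doubleton)

lemma card_R_pos: "1 \<le> card R"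
  using finite_R R_ne by (simp add: Suc_leI card_gt_0_iff)

lemma TMST_eq: "TMST V E c R = real (card R) - 1"
  unfolding TMST_def mst_cost_def
proof (rule Min_eqI)
  have finC: "finite (complete_edges R)"
    by (rule finite_subset[of _ "Pow R"]) (use finite_R in \<open>auto simp: complete_edges_def\<close>)
  have sum_eq: "sum (closure_cost V E c) F = real (card F)" if "F \<subseteq> complete_edges R" for F
    using that closure_cost_terminals by (simp add: subset_eq)
  have "{sum (closure_cost V E c) F | F. F \<subseteq> complete_edges R \<and> tree R F} \<subseteq>
      sum (closure_cost V E c) ` Pow (complete_edges R)" by auto
  then show "finite {sum (closure_cost V E c) F | F. F \<subseteq> complete_edges R \<and> tree R F}"
    using finC finite_subset by blast
  show "real (card R) - 1 \<le> d"
    if d: "d \<in> {sum (closure_cost V E c) F | F. F \<subseteq> complete_edges R \<and> tree R F}" for d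
  proof -
    obtain F where F: "F \<subseteq> complete_edges R" "tree R F" "d = sum (closure_cost V E c) F"
      using d by auto
    have "card R \<le> Suc (card F)"
    proof (rule connected_card_le)
      show "finite F" using F finC finite_subset by blast
      show "v \<in> R" if "{u, v} \<in> F" for u v
        using that F(2) by (auto simp: tree_def simple_graph_def)
    qed (use F finite_R connected_rtrancl_arcs in \<open>auto simp: tree_def\<close>)
    then show ?thesis using F sum_eq[OF F(1)] by simp
  qed
  obtain x where x: "x \<in> R" using R_ne by auto
  have sub: "star_edges x R \<subseteq> complete_edges R"
    using x by (auto simp: star_edges_def complete_edges_def)
  have "real (card R) - 1 = sum (closure_cost V E c) (star_edges x R)"
    using sum_eq[OF sub] card_star_edges[OF finite_R x] card_R_pos by simp
  then show "real (card R) - 1 \<in> {sum (closure_cost V E c) F | F. F \<subseteq> complete_edges R \<and> tree R F}"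
    using sub tree_star_edges[OF finite_R x] by blast
qed

lemma OPT_eq: "OPT V E c R = real (card R) - 1"
  unfolding OPT_def
proof (rule Min_eqI)
  have "{sum c F | W F. steiner_tree V E R W F} \<subseteq> sum c ` Pow E"
    by (auto simp: steiner_tree_def)
  then show "finite {sum c F | W F. steiner_tree V E R W F}" using finite_E finite_subset by blast
  show "real (card R) - 1 \<le> d" if d: "d \<in> {sum c F | W F. steiner_tree V E R W F}" for d
  proof -
    obtain W F where F: "steiner_tree V E R W F" "d = sum c F" using d by auto
    then show ?thesis
      using connected_cost_ge[of W F] by (auto simp: steiner_tree_def tree_def simple_graph_def)
  qed
  obtain x where x: "x \<in> R" using R_ne by auto
  have "star_edges x R \<subseteq> E" using x unit by (auto simp: star_edges_def)
  then have "steiner_tree V E R R (star_edges x R)"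
    using tree_star_edges[OF finite_R x] R_sub by (simp add: steiner_tree_def)
  moreover have "sum c (star_edges x R) = (\<Sum>e\<in>star_edges x R. 1)"
    using x unit by (intro sum.cong) (auto simp: star_edges_def)
  then have "real (card R) - 1 = sum c (star_edges x R)"
    using card_star_edges[OF finite_R x] card_R_pos by simp
  ultimately show "real (card R) - 1 \<in> {sum c F | W F. steiner_tree V E R W F}" by blast
qed

lemma mst_optimal: "mst_optimal V E c R"
  by (simp add: mst_optimal_def TMST_eq OPT_eq)

end


section \<open>Moat growing\<close>

lemma delta_out_arc: "(u, v) \<in> arcs E \<Longrightarrow> (u, v) \<in> delta_out E X \<longleftrightarrow> u \<in> X \<and> v \<notin> X"
  by (auto simp: delta_out_def)

lemma subset_moat: "S \<subseteq> moat V E c y S"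
  by (auto simp: moat_def)

lemma moat_mono:
  assumes "tight_arcs V E c y \<subseteq> tight_arcs V E c y'" "S \<subseteq> S'"
  shows "moat V E c y S \<subseteq> moat V E c y' S'"
  unfolding moat_def using rtrancl_mono[OF assms(1)] assms(2) by blast

lemma moat_tight:
  assumes "u \<in> moat V E c y S" "(u, v) \<in> tight_arcs V E c y"
  shows "v \<in> moat V E c y S"
  using assms unfolding moat_def by (auto intro: rtrancl_into_rtrancl)

text \<open>
  Runs are the same process except that a growth phase may be cut at any time; this is used to make
  the phases end at the times in B.
\<close>

inductive run ::
    "'a set \<Rightarrow> 'a set set \<Rightarrow> ('a set \<Rightarrow> real) \<Rightarrow> (real \<Rightarrow> 'a set set) \<Rightarrow> real set \<Rightarrow> real \<Rightarrow> ('a set \<Rightarrow> real) \<Rightarrow> bool"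
  for V E c M B where
  run_start: "run V E c M B 0 (\<lambda>_. 0)"
| run_step: "run V E c M B t' (grow V E c P (t' - t) y)"
  if "run V E c M B t y"
    and "t < t'"
    and "B \<inter> {t<..<t'} = {}"
    and "\<forall>s\<in>{t<..t'}. M s = P"
    and "\<forall>s\<in>{t<..<t'}. tight_arcs V E c (grow V E c P (s - t) y) \<subseteq> tight_arcs V E c y"

locale moat_growing =
  fixes V :: "'a set" and E c R M
  assumes inst: "steiner_instance V E c R"
    and plan: "merge_plan R M"
begin

abbreviation "ld \<equiv> load V E"
abbreviation "tight \<equiv> tight_arcs V E c"
abbreviation "mt \<equiv> moat V E c"
abbreviation "gr \<equiv> grow V E c"

lemma finite_V: "finite V" and edge_sub: "e \<in> E \<Longrightarrow> e \<subseteq> V" and R_sub: "R \<subseteq> V"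
  and c_pos: "e \<in> E \<Longrightarrow> 0 < c e"
  using inst by (auto simp: steiner_instance_def simple_graph_def)

lemma finite_R: "finite R"
  using finite_V R_sub finite_subset by blast

section \<open>Partitions of a merge plan\<close>

lemma part: "0 \<le> t \<Longrightarrow> partition_on R (M t)"
  using plan by (simp add: merge_plan_def)

lemma part_sub: "0 \<le> t \<Longrightarrow> S \<in> M t \<Longrightarrow> S \<subseteq> R"
  using part partition_onD1 by fastforce

lemma part_ne: "0 \<le> t \<Longrightarrow> S \<in> M t \<Longrightarrow> S \<noteq> {}"
  using part partition_onD3 by fastforce

lemma part_ex: "0 \<le> t \<Longrightarrow> x \<in> R \<Longrightarrow> \<exists>S\<in>M t. x \<in> S"
  using partition_onD1[OF part[of t]] by auto

lemma part_unique:
  assumes "0 \<le> t" "S \<in> M t" "S' \<in> M t" "x \<in> S" "x \<in> S'"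
  shows "S = S'"
  using partition_onD2[OF part[OF assms(1)]] assms by (auto simp: disjoint_def)

lemma finite_part: "0 \<le> t \<Longrightarrow> finite (M t)"
  by (rule finite_subset[of _ "Pow R"]) (use part_sub finite_R in auto)

text \<open>The merge time is a threshold: two terminals in a common part at time \<open>s\<close>
  are past it and remain together.\<close>

lemma coarsening:
  assumes "0 \<le> s" "s \<le> s'" "S \<in> M s" "S' \<in> M s'" "x \<in> S" "x \<in> S'"
  shows "S \<subseteq> S'"
proof
  fix z assume z: "z \<in> S"
  show "z \<in> S'"
  proof (cases "z = x")
    case False
    have R: "x \<in> R" "z \<in> R" using part_sub assms z by blast+
    have "\<exists>m\<ge>0. \<forall>t\<ge>0. (\<nexists>S. S \<in> M t \<and> x \<in> S \<and> z \<in> S) \<longleftrightarrow> t \<le> m"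
      using plan False R unfolding merge_plan_def by simp
    then obtain m where m: "\<forall>t\<ge>0. (\<nexists>S. S \<in> M t \<and> x \<in> S \<and> z \<in> S) \<longleftrightarrow> t \<le> m"
      by blast
    then have "\<not> s \<le> m" using assms z by blast
    then have "\<not> s' \<le> m" using assms by simp
    moreover have "0 \<le> s'" using assms by simp
    ultimately obtain S'' where S'': "S'' \<in> M s'" "x \<in> S''" "z \<in> S''" using m by blast
    have "S'' = S'" using part_unique[of s' S'' S' x] \<open>0 \<le> s'\<close> assms S'' by simp
    then show ?thesis using S'' by simp
  qed (use assms in simp)
qed

lemma arc_V: "(u, v) \<in> arcs E \<Longrightarrow> u \<in> V \<and> v \<in> V"
  using edge_sub[of "{u, v}"] by (simp add: arcs_def)

lemma tight_arc: "tight y \<subseteq> arcs E"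
  by (auto simp: tight_arcs_def)

lemma moat_sub:
  assumes "S \<subseteq> R"
  shows "mt y S \<subseteq> V"
proof
  fix v assume "v \<in> mt y S"
  then obtain x where x: "x \<in> S" "(x, v) \<in> (tight y)\<^sup>*" by (auto simp: moat_def)
  from x(2) show "v \<in> V"
  proof (induction rule: rtrancl_induct)
    case base
    then show ?case using x(1) assms R_sub by auto
  next
    case (step v w)
    then have "(v, w) \<in> arcs E" using tight_arc by auto
    then show ?case using arc_V by simp
  qed
qed

section \<open>How growth changes loads\<close>

definition pushing :: "('a set \<Rightarrow> real) \<Rightarrow> 'a set set \<Rightarrow> 'a \<Rightarrow> 'a \<Rightarrow> 'a set set" where
  "pushing y P u v = {S \<in> P. u \<in> mt y S \<and> v \<notin> mt y S}"

text \<open>Common source of the growth rates of loads and of the dual value: equal moats are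
  counted with multiplicity in \<open>grow\<close>, so the rate is a number of parts, not of vertex
  sets.\<close>

lemma sum_grow:
  assumes "finite P" "finite \<U>" "\<And>S. S \<in> P \<Longrightarrow> Q (mt y S) \<Longrightarrow> mt y S \<in> \<U>"
  shows "(\<Sum>U | U \<in> \<U> \<and> Q U. gr P d y U) = (\<Sum>U | U \<in> \<U> \<and> Q U. y U) + d * real (card {S \<in> P. Q (mt y S)})"
proof -
  have "(\<Sum>U | U \<in> \<U> \<and> Q U. real (card {S \<in> P. mt y S = U}))
      = (\<Sum>U | U \<in> \<U> \<and> Q U. \<Sum>S\<in>P. of_bool (mt y S = U))"
    using assms(1) by (simp add: Int_def)
  also have "\<dots> = (\<Sum>S\<in>P. \<Sum>U | U \<in> \<U> \<and> Q U. of_bool (mt y S = U))" by (rule sum.swap)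
  also have "\<dots> = (\<Sum>S\<in>P. of_bool (Q (mt y S)))"
  proof (rule sum.cong)
    fix S assume "S \<in> P"
    then have "{U. U \<in> \<U> \<and> Q U} \<inter> {U. mt y S = U} = (if Q (mt y S) then {mt y S} else {})"
      using assms(3) by auto
    then show "(\<Sum>U | U \<in> \<U> \<and> Q U. of_bool (mt y S = U)) = (of_bool (Q (mt y S)) :: real)"
      using assms(2) by simp
  qed simp
  also have "\<dots> = real (card {S \<in> P. Q (mt y S)})" using assms(1) by (simp add: Int_def)
  finally have "(\<Sum>U | U \<in> \<U> \<and> Q U. real (card {S \<in> P. mt y S = U})) = real (card {S \<in> P. Q (mt y S)})" .
  then show ?thesis by (simp add: grow_def sum.distrib flip: sum_distrib_left)
qed

lemma load_grow:
  assumes P: "finite P" "\<And>S. S \<in> P \<Longrightarrow> S \<subseteq> R" and a: "(u, v) \<in> arcs E"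
  shows "ld (gr P d y) (u, v) = ld y (u, v) + d * real (card (pushing y P u v))"
  using sum_grow[of P "Pow V" "\<lambda>U. (u, v) \<in> delta_out E U" y d] P moat_sub finite_V
  by (simp add: load_def pushing_def delta_out_arc[OF a])

lemma tight_iff: "(u, v) \<in> tight y \<longleftrightarrow> (u, v) \<in> arcs E \<and> ld y (u, v) = c {u, v}"
  by (simp add: tight_arcs_def)

lemma pushing_tight: "(u, v) \<in> tight y \<Longrightarrow> pushing y P u v = {}"
  using moat_tight by (fastforce simp: pushing_def)

lemma tight_grow:
  assumes P: "finite P" "\<And>S. S \<in> P \<Longrightarrow> S \<subseteq> R"
  shows "tight y \<subseteq> tight (gr P d y)"
proof clarify
  fix u v assume "(u, v) \<in> tight y"
  moreover from this have "pushing y P u v = {}" by (rule pushing_tight)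
  ultimately show "(u, v) \<in> tight (gr P d y)"
    using load_grow[OF P] by (auto simp: tight_iff)
qed

text \<open>This allows a phase to be cut: as long as no further arc is tight, the moats are the
  same after the cut and the two growths add up.\<close>

lemma grow_grow:
  assumes "finite P" "\<And>S. S \<in> P \<Longrightarrow> S \<subseteq> R" "tight (gr P d y) \<subseteq> tight y"
  shows "gr P d' (gr P d y) = gr P (d + d') y"
proof -
  have "tight (gr P d y) = tight y" using assms tight_grow[of P y d] by blast
  then show ?thesis by (auto simp: grow_def moat_def algebra_simps)
qed

section \<open>Phases and runs\<close>

definition is_phase :: "real \<Rightarrow> ('a set \<Rightarrow> real) \<Rightarrow> real \<Rightarrow> 'a set set \<Rightarrow> bool" where
  "is_phase t y t' P \<longleftrightarrow> 0 \<le> t \<and> t < t' \<and> (\<forall>s\<in>{t<..t'}. M s = P) \<and>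
     (\<forall>s\<in>{t<..<t'}. tight (gr P (s - t) y) \<subseteq> tight y)"

lemma phase_parts:
  assumes "is_phase t y t' P"
  shows "M t' = P" "finite P" "\<And>S. S \<in> P \<Longrightarrow> S \<subseteq> R"
proof -
  show "M t' = P" "finite P" "\<And>S. S \<in> P \<Longrightarrow> S \<subseteq> R"
    using assms finite_part[of t'] part_sub[of t'] by (auto simp: is_phase_def)
qed

lemma run_nonneg: "run V E c M B t y \<Longrightarrow> 0 \<le> t"
  by (induction rule: run.induct) auto

text \<open>Induction on the number of points of \<open>B\<close> strictly inside the phase; cutting
  at one of them leaves fewer on either side.\<close>

lemma run_phase:
  assumes "run V E c M B t y" "is_phase t y t' P" "finite B"
  shows "run V E c M B t' (gr P (t' - t) y)"
  using assms(1,2)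
proof (induction "card (B \<inter> {t<..<t'})" arbitrary: t t' y rule: less_induct)
  case less
  note ph = less.prems(2)
  show ?case
  proof (cases "B \<inter> {t<..<t'} = {}")
    case True
    then show ?thesis using ph by (intro run_step[OF less.prems(1)]) (auto simp: is_phase_def)
  next
    case False
    then obtain s where s: "s \<in> B" "t < s" "s < t'" by auto
    have c1: "card (B \<inter> {t<..<s}) < card (B \<inter> {t<..<t'})"
      and c2: "card (B \<inter> {s<..<t'}) < card (B \<inter> {t<..<t'})"
      using s assms(3) by (auto intro!: psubset_card_mono)
    have "is_phase t y s P" using ph s by (auto simp: is_phase_def)
    then have r: "run V E c M B s (gr P (s - t) y)" using less.hyps[OF c1] less.prems by blast
    have sub: "tight (gr P (s - t) y) \<subseteq> tight y" using ph s by (auto simp: is_phase_def)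
    have gg: "gr P d (gr P (s - t) y) = gr P (s - t + d) y" for d
      using grow_grow[of P "s - t" y d] phase_parts[OF ph] sub by blast
    have mono: "tight y \<subseteq> tight (gr P (s - t) y)"
      using tight_grow[of P y "s - t"] phase_parts[OF ph] by blast
    have "is_phase s (gr P (s - t) y) t' P"
      unfolding is_phase_def
    proof (intro conjI ballI)
      show "0 \<le> s" "s < t'" using ph s by (auto simp: is_phase_def)
      show "M q = P" if "q \<in> {s<..t'}" for q using that ph s by (auto simp: is_phase_def)
      show "tight (gr P (q - s) (gr P (s - t) y)) \<subseteq> tight (gr P (s - t) y)" if q: "q \<in> {s<..<t'}" for q
      proof -
        have "tight (gr P (q - t) y) \<subseteq> tight y" using ph s q by (auto simp: is_phase_def)
        then show ?thesis
          using mono by (simp add: gg)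
      qed
    qed
    then have "run V E c M B t' (gr P (t' - s) (gr P (s - t) y))" using less.hyps[OF c2] r by blast
    then show ?thesis by (simp add: gg)
  qed
qed

lemma moat_state_run:
  assumes "moat_state V E c M t y" "finite B"
  shows "run V E c M B t y"
  using assms(1)
proof (induction rule: moat_state.induct)
  case (step t y t' P)
  then show ?case using run_nonneg assms(2) by (intro run_phase) (auto simp: is_phase_def)
qed (rule run_start)

lemma run_induct [consumes 1, case_names start phase]:
  assumes "run V E c M B t y"
    and "Q 0 (\<lambda>_. 0)"
    and "\<And>t y t' P. run V E c M B t y \<Longrightarrow> Q t y \<Longrightarrow> is_phase t y t' P \<Longrightarrow> B \<inter> {t<..<t'} = {} \<Longrightarrow>
      Q t' (gr P (t' - t) y)"
  shows "Q t y"
  using assms(1)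
proof (induction rule: run.induct)
  case (run_step t y t' P)
  then show ?case using run_nonneg by (intro assms(3)) (auto simp: is_phase_def)
qed (rule assms(2))

lemma load_phase:
  assumes "is_phase t y t' P" "(u, v) \<in> arcs E"
  shows "ld (gr P (t' - t) y) (u, v) = ld y (u, v) + (t' - t) * real (card (pushing y P u v))"
  using load_grow[OF _ _ assms(2)] phase_parts[OF assms(1)] by blast

lemma load_phase_le:
  assumes "is_phase t y t' P" "(u, v) \<in> arcs E" "card (pushing y P u v) \<le> k"
  shows "ld (gr P (t' - t) y) (u, v) \<le> ld y (u, v) + (t' - t) * real k"
  unfolding load_phase[OF assms(1,2)] using assms(1,3)
  by (intro add_left_mono mult_left_mono) (auto simp: is_phase_def)

lemma load_phase_ge:
  assumes "is_phase t y t' P" "(u, v) \<in> arcs E" "k \<le> card (pushing y P u v)"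
  shows "ld y (u, v) + (t' - t) * real k \<le> ld (gr P (t' - t) y) (u, v)"
  unfolding load_phase[OF assms(1,2)] using assms(1,3)
  by (intro add_left_mono mult_left_mono) (auto simp: is_phase_def)

lemma finite_pushing: "is_phase t y t' P \<Longrightarrow> finite (pushing y P u v)"
  using phase_parts by (simp add: pushing_def)

lemma load_zero: "ld (\<lambda>_. 0) a = 0"
  by (simp add: load_def)

lemma load_nonneg: "run V E c M B t y \<Longrightarrow> (u, v) \<in> arcs E \<Longrightarrow> 0 \<le> ld y (u, v)"
proof (induction rule: run_induct)
  case (phase t y t' P)
  then show ?case using load_phase_ge[OF phase.hyps(2), of u v 0] by auto
qed (simp add: load_zero)

text \<open>Within a phase the load is linear in time. If it exceeded the cost at the end without
  having been tight at the start, then it would equal the cost at the inner time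
  \<open>t + d\<close>, where no arc may be newly tight.\<close>

lemma load_le:
  assumes "run V E c M B t y" "(u, v) \<in> arcs E"
  shows "ld y (u, v) \<le> c {u, v}"
  using assms(1)
proof (induction rule: run_induct)
  case start
  then show ?case using c_pos assms(2) by (simp add: load_zero arcs_def less_imp_le)
next
  case (phase t y t' P)
  define k where "k = real (card (pushing y P u v))"
  have *: "ld (gr P d y) (u, v) = ld y (u, v) + d * k" for d
    unfolding k_def using load_grow[OF _ _ assms(2)] phase_parts[OF phase.hyps(2)] by blast
  show ?case
  proof (cases "ld y (u, v) = c {u, v}")
    case True
    then have "k = 0" using pushing_tight[of u v y] assms(2) by (simp add: tight_iff k_def)
    then show ?thesis using True * by simp
  next
    case False
    show ?thesis
    proof (rule ccontr)
      assume "\<not> ?thesis"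
      then have gt: "c {u, v} < ld y (u, v) + (t' - t) * k" using * by simp
      then have "k \<noteq> 0" using phase.IH by auto
      then have "k > 0" by (simp add: k_def)
      define d where "d = (c {u, v} - ld y (u, v)) / k"
      have "0 < d" "d < t' - t" using False phase.IH gt \<open>k > 0\<close> by (auto simp: d_def field_simps)
      moreover have "d * k = c {u, v} - ld y (u, v)" using \<open>k > 0\<close> by (simp add: d_def)
      then have "(u, v) \<in> tight (gr P d y)" using assms(2) * by (simp add: tight_iff)
      ultimately have "(u, v) \<in> tight y"
        using phase.hyps(2) unfolding is_phase_def by (metis add_diff_cancel_left' greaterThanLessThan_iff less_add_same_cancel1 less_diff_eq add.commute subsetD)
      then show False using False by (simp add: tight_iff)
    qed
  qed
qed

lemma load_ge_tight:
  assumes "run V E c M B t y" "(u, v) \<in> arcs E" "c {u, v} \<le> ld y (u, v)"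
  shows "(u, v) \<in> tight y"
  using load_le[OF assms(1,2)] assms(2,3) by (simp add: tight_iff)

lemma tight_phase:
  assumes "is_phase t y t' P"
  shows "tight y \<subseteq> tight (gr P (t' - t) y)"
  using tight_grow phase_parts[OF assms] by blast

text \<open>All times \<open>s > t\<close> are considered because \<open>M t\<close> itself need not
  govern the growth after \<open>t\<close>. Speaking of a terminal \<open>x\<close> instead of its
  part makes the notion stable under merging.\<close>

definition reached :: "real \<Rightarrow> ('a set \<Rightarrow> real) \<Rightarrow> 'a \<Rightarrow> 'a \<Rightarrow> bool" where
  "reached t y x v \<longleftrightarrow> (\<forall>s>t. \<forall>S\<in>M s. x \<in> S \<longrightarrow> v \<in> mt y S)"

lemma reached_refl: "reached t y x x"
  unfolding reached_def using subset_moat by (metis subsetD)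

lemma reached_tight: "reached t y x u \<Longrightarrow> (u, v) \<in> tight y \<Longrightarrow> reached t y x v"
  unfolding reached_def using moat_tight[of u V E c y _ v] by simp

lemma reached_phase:
  assumes "reached t y x v" "is_phase t y t' P"
  shows "reached t' (gr P (t' - t) y) x v"
  unfolding reached_def
proof (intro allI impI ballI)
  fix s S assume s: "t' < s" "S \<in> M s" "x \<in> S"
  have "t < s" using assms(2) s(1) by (simp add: is_phase_def)
  then have "v \<in> mt y S" using assms(1) s by (simp add: reached_def)
  then show "v \<in> mt (gr P (t' - t) y) S"
    using moat_mono[OF tight_phase[OF assms(2)] order_refl[of S]] by (rule subsetD[rotated])
qed

lemma phase_reachedD:
  assumes "reached t y x v" "is_phase t y t' P" "S \<in> P" "x \<in> S"
  shows "v \<in> mt y S"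
proof -
  have "t < t'" using assms(2) by (simp add: is_phase_def)
  moreover have "S \<in> M t'" using assms(3) phase_parts(1)[OF assms(2)] by simp
  ultimately show ?thesis using assms(1,4) by (simp add: reached_def)
qed

text \<open>The partition \<open>P\<close> is in force immediately after \<open>t\<close>, so
  \<open>t < s\<close> is enough, even for \<open>s\<close> before the end of the phase.\<close>

lemma phase_coarsening:
  assumes "is_phase t y t' P" "S \<in> P" "x \<in> S" "t < s" "S' \<in> M s" "x \<in> S'"
  shows "S \<subseteq> S'"
proof -
  have t': "0 \<le> t'" "M t' = P" "\<And>s. t < s \<Longrightarrow> s \<le> t' \<Longrightarrow> M s = P"
    using assms(1) phase_parts(1)[OF assms(1)] by (auto simp: is_phase_def)
  show ?thesis
  proof (cases "s \<le> t'")
    case True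
    then have "S' \<in> M t'" using assms(4,5) t' by metis
    then show ?thesis using part_unique[of t' S S' x] assms(2,3,6) t' by simp
  next
    case False
    then show ?thesis using coarsening[of t' s S S' x] assms t' by simp
  qed
qed

lemma phase_reachedI:
  assumes "is_phase t y t' P" "S \<in> P" "x \<in> S" "v \<in> mt y S"
  shows "reached t y x v"
  unfolding reached_def
proof (intro allI impI ballI)
  fix s S' assume "t < s" "S' \<in> M s" "x \<in> S'"
  then have "S \<subseteq> S'" using phase_coarsening[OF assms(1-3)] by simp
  then show "v \<in> mt y S'"
    using subsetD[OF moat_mono[OF order_refl] assms(4)] by simp
qed

lemma phase_part_ex:
  assumes "is_phase t y t' P" "x \<in> R"
  obtains S where "S \<in> P" "x \<in> S"
proof -
  have "0 \<le> t'" using assms(1) by (simp add: is_phase_def)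
  then show ?thesis using part_ex[of t' x] assms(2) phase_parts(1)[OF assms(1)] that by auto
qed

lemma phase_unique:
  assumes "is_phase t y t' P" "S \<in> P" "S' \<in> P" "x \<in> S" "x \<in> S'"
  shows "S = S'"
proof -
  have "0 \<le> t'" using assms(1) by (simp add: is_phase_def)
  then show ?thesis using part_unique[of t' S S' x] assms phase_parts(1)[OF assms(1)] by simp
qed

lemma card_pushing_le_1:
  assumes "is_phase t y t' P" "\<And>S. S \<in> pushing y P u v \<Longrightarrow> p \<in> S"
  shows "card (pushing y P u v) \<le> 1"
proof -
  have "S = S'" if "S \<in> pushing y P u v" "S' \<in> pushing y P u v" for S S'
    using that assms(2) phase_unique[OF assms(1), of S S' p] by (simp add: pushing_def)
  then show ?thesis using card_le_Suc0_iff_eq[OF finite_pushing[OF assms(1)]] by simp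
qed

lemma card_pushing_ge:
  assumes ph: "is_phase t y t' P" and X: "X \<subseteq> R"
    and push: "\<And>x S. x \<in> X \<Longrightarrow> S \<in> P \<Longrightarrow> x \<in> S \<Longrightarrow> u \<in> mt y S \<and> v \<notin> mt y S"
    and sep: "\<And>x x' S. x \<in> X \<Longrightarrow> x' \<in> X \<Longrightarrow> S \<in> P \<Longrightarrow> x \<in> S \<Longrightarrow> x' \<in> S \<Longrightarrow> x = x'"
  shows "card X \<le> card (pushing y P u v)"
proof -
  have "\<exists>S. S \<in> P \<and> x \<in> S" if "x \<in> X" for x
    using phase_part_ex[OF ph, of x] X that by (metis subsetD)
  then obtain f where f: "\<And>x. x \<in> X \<Longrightarrow> f x \<in> P \<and> x \<in> f x" by metis
  have "inj_on f X"
  proof (rule inj_onI)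
    fix x x' assume "x \<in> X" "x' \<in> X" "f x = f x'"
    then show "x = x'" using sep[of x x' "f x"] f[of x] f[of x'] by simp
  qed
  moreover have "f ` X \<subseteq> pushing y P u v"
  proof clarify
    fix x assume "x \<in> X"
    then show "f x \<in> pushing y P u v" using f[of x] push[of x "f x"] by (simp add: pushing_def)
  qed
  ultimately show ?thesis using finite_pushing[OF ph] by (metis card_inj_on_le)
qed

text \<open>\<open>Q\<close> is a property that passes to earlier states, typically that the head of
  the arc has not been reached. It is known at the end, hence available in every earlier phase to
  show that parts do push. Phases do not run across \<open>t0\<close> or \<open>t1\<close>, since
  these are points where runs are cut; alternatively \<open>t0\<close> is 0, or \<open>Q\<close>
  keeps the time below \<open>t1\<close>.\<close>

lemma load_lower:
  assumes run: "run V E c M B t y" and Q: "Q t y" and t: "t0 \<le> t" and t0: "0 \<le> t0" "t0 \<in> B \<or> t0 = 0"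
    and t1: "t1 \<in> B \<or> (\<forall>t y. Q t y \<longrightarrow> t \<le> t1)" and a: "(u, v) \<in> arcs E"
    and bwd: "\<And>t y t' P. is_phase t y t' P \<Longrightarrow> Q t' (gr P (t' - t) y) \<Longrightarrow> Q t y"
    and push: "\<And>t y t' P. run V E c M B t y \<Longrightarrow> is_phase t y t' P \<Longrightarrow> t0 \<le> t \<Longrightarrow> t < t1 \<Longrightarrow>
      Q t' (gr P (t' - t) y) \<Longrightarrow> k \<le> card (pushing y P u v)"
  shows "real k * (min t t1 - t0) \<le> ld y (u, v)"
proof -
  have "Q t y \<longrightarrow> t0 \<le> t \<longrightarrow> real k * (min t t1 - t0) \<le> ld y (u, v)"
    using run
  proof (induction rule: run_induct)
    case start
    have "real k * (min 0 t1 - t0) \<le> 0" using t0 by (intro mult_nonneg_nonpos) auto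
    then show ?case by (simp add: load_zero)
  next
    case (phase t y t' P)
    let ?y = "gr P (t' - t) y"
    show ?case
    proof (intro impI)
      assume Q': "Q t' ?y" and le: "t0 \<le> t'"
      have Qt: "Q t y" using bwd[OF phase.hyps(2) Q'] .
      have tt: "0 \<le> t" "t < t'" using phase.hyps(2) by (auto simp: is_phase_def)
      have mono: "ld y (u, v) \<le> ld ?y (u, v)"
        using load_phase_ge[OF phase.hyps(2) a, of 0] by simp
      \<comment> \<open>A phase that begins before \<open>t0\<close> ends at \<open>t0\<close> at
        the latest, because \<open>t0\<close> is a point of \<open>B\<close> or 0.\<close>
      consider "t0 = t'" | "t0 \<le> t" "t1 \<le> t" | "t0 \<le> t" "t < t1"
        using phase.hyps(3) t0 le tt by force
      then show "real k * (min t' t1 - t0) \<le> ld ?y (u, v)"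
      proof cases
        case 1
        have "0 \<le> ld y (u, v)"
          using load_nonneg[OF phase.hyps(1) a] .
        moreover have "real k * (min t' t1 - t0) \<le> 0" using 1 by (intro mult_nonneg_nonpos) auto
        ultimately show ?thesis using mono by linarith
      next
        case 2
        then have "min t' t1 = min t t1" using tt by simp
        then show ?thesis using phase.IH Qt 2 mono by auto
      next
        case 3
        then have "t' \<le> t1" using t1 phase.hyps(3) Q' by (force simp: not_le)
        then have "min t' t1 = t'" "min t t1 = t" using tt by auto
        moreover have "ld y (u, v) + (t' - t) * real k \<le> ld ?y (u, v)"
          using load_phase_ge[OF phase.hyps(2) a push[OF phase.hyps(1,2) 3 Q']] .
        moreover have "real k * (t - t0) \<le> ld y (u, v)" using phase.IH Qt 3 \<open>min t t1 = t\<close> by simp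
        ultimately show ?thesis by (simp add: algebra_simps)
      qed
    qed
  qed
  then show ?thesis using Q t by blast
qed

text \<open>As long as \<open>v\<close> is missed, the part of \<open>x\<close> holds
  \<open>u\<close> and not \<open>v\<close>, so it pushes the arc at rate 1 from \<open>t0\<close>
  on. Thus the arc is tight after a time of at most its cost, unless \<open>v\<close> is reached in
  another way.\<close>

lemma reached_arc:
  assumes run: "run V E c M B t y" and t: "t0 + c {u, v} \<le> t" and a: "(u, v) \<in> arcs E"
    and x: "x \<in> R" and t0: "0 \<le> t0" "t0 \<in> B \<or> t0 = 0"
    and u: "\<And>t y. run V E c M B t y \<Longrightarrow> t0 \<le> t \<Longrightarrow> reached t y x u"
  shows "reached t y x v"
proof (rule ccontr)
  assume nv: "\<not> reached t y x v"
  have c: "0 < c {u, v}" using a c_pos by (simp add: arcs_def)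
  have "real 1 * (min t t - t0) \<le> ld y (u, v)"
  proof (rule load_lower[where Q = "\<lambda>s y. \<not> reached s y x v \<and> s \<le> t", OF run _ _ t0 _ a])
    fix s y t' P
    assume run: "run V E c M B s y" and ph: "is_phase s y t' P" and s: "t0 \<le> s"
      and nr: "\<not> reached t' (gr P (t' - s) y) x v \<and> t' \<le> t"
    have ns: "\<not> reached s y x v" using nr reached_phase ph by blast
    have "card {x} \<le> card (pushing y P u v)"
      using phase_reachedD[OF u[OF run s] ph] phase_reachedI[OF ph] ns x
      by (intro card_pushing_ge[OF ph]) auto
    then show "1 \<le> card (pushing y P u v)" by simp
  next
    show "\<not> reached s y x v \<and> s \<le> t"
      if "is_phase s y t' P" "\<not> reached t' (gr P (t' - s) y) x v \<and> t' \<le> t" for s y t' P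
      using that reached_phase by (auto simp: is_phase_def)
  qed (use nv t c in auto)
  then have "(u, v) \<in> tight y" using load_ge_tight[OF run a] t by simp
  then show False using reached_tight u[OF run] nv t c by simp
qed

section \<open>Growth of the dual value\<close>

lemma card_part_le:
  assumes "0 \<le> t" "P \<subseteq> M t"
  obtains X where "X \<subseteq> \<Union>P" "card X = card P" "\<And>x x' S. x \<in> X \<Longrightarrow> x' \<in> X \<Longrightarrow> S \<in> M t \<Longrightarrow> x \<in> S \<Longrightarrow> x' \<in> S \<Longrightarrow> x = x'"
proof -
  have "\<forall>S\<in>P. \<exists>x. x \<in> S" using part_ne[OF assms(1)] assms(2) by blast
  then obtain f where f: "\<And>S. S \<in> P \<Longrightarrow> f S \<in> S" by metis
  have u: "S = S'" if "S \<in> P" "S' \<in> M t" "f S \<in> S'" for S S'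
    using part_unique[OF assms(1), of S S' "f S"] f that assms(2) by blast
  then have "inj_on f P" using f assms(2) by (intro inj_onI) (metis subsetD)
  then have "card (f ` P) = card P" by (rule card_image)
  moreover have "f ` P \<subseteq> \<Union>P" using f by blast
  ultimately show ?thesis using u by (intro that[of "f ` P"]) blast+
qed

lemma dual_value_phase:
  assumes "is_phase t y t' P" "r \<in> R"
  shows "dual_value V R r (gr P (t' - t) y) = dual_value V R r y + (t' - t) * real (card {S \<in> P. r \<notin> mt y S})"
proof -
  have iff: "mt y S \<subseteq> V - {r} \<and> mt y S \<inter> R \<noteq> {} \<longleftrightarrow> r \<notin> mt y S" if "S \<in> P" for S
  proof -
    have "S \<subseteq> R" "S \<noteq> {}"
      using that phase_parts[OF assms(1)] assms(1) part_ne[of t' S] by (auto simp: is_phase_def)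
    then show ?thesis using moat_sub[of S y] subset_moat[of S V E c y] by blast
  qed
  have "{S \<in> P. mt y S \<subseteq> V - {r} \<and> mt y S \<inter> R \<noteq> {}} = {S \<in> P. r \<notin> mt y S}"
    using iff by blast
  moreover have sub: "{U \<in> Pow V. U \<subseteq> V - {r} \<and> U \<inter> R \<noteq> {}} = {U. U \<subseteq> V - {r} \<and> U \<inter> R \<noteq> {}}"
    by blast
  ultimately show ?thesis
    using sum_grow[of P "Pow V" "\<lambda>U. U \<subseteq> V - {r} \<and> U \<inter> R \<noteq> {}" y "t' - t"] sub
      phase_parts[OF assms(1)] moat_sub finite_V
    by (simp add: dual_value_def)
qed

text \<open>Since \<open>T\<close> and 1 belong to \<open>B\<close>, each phase lies in one of three
  periods: the value grows at rate at most \<open>card R\<close> until \<open>T\<close>, at most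
  \<open>k\<close> until 1, and not at all afterwards.\<close>

lemma dual_value_le:
  assumes run: "run V E c M B t y" and r: "r \<in> R" and T: "0 \<le> T" "T \<le> 1" "T \<in> B" "1 \<in> B"
    and few: "\<And>t y t' P. run V E c M B t y \<Longrightarrow> is_phase t y t' P \<Longrightarrow> T \<le> t \<Longrightarrow> card {S \<in> P. r \<notin> mt y S} \<le> k"
    and none: "\<And>t y t' P. run V E c M B t y \<Longrightarrow> is_phase t y t' P \<Longrightarrow> 1 \<le> t \<Longrightarrow> {S \<in> P. r \<notin> mt y S} = {}"
  shows "dual_value V R r y \<le> real (card R) * T + real k"
proof -
  have "dual_value V R r y \<le> real (card R) * min t T + real k * max 0 (min t 1 - T)"
    using run
  proof (induction rule: run_induct)
    case start
    then show ?case using T by (simp add: dual_value_def)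
  next
    case (phase t y t' P)
    note ph = phase.hyps(2)
    have tt: "0 \<le> t" "t < t'" using ph by (auto simp: is_phase_def)
    let ?n = "real (card {S \<in> P. r \<notin> mt y S})"
    note dv = dual_value_phase[OF ph r]
    consider "t' \<le> T" | "T \<le> t" "t' \<le> 1" | "1 \<le> t"
      using phase.hyps(3) T tt by force
    then show ?case
    proof cases
      case 1
      obtain X where "X \<subseteq> \<Union>P" "card X = card P"
        by (rule card_part_le[of t' P]) (use tt phase_parts[OF ph] in auto)
      then have "card P \<le> card R"
        using phase_parts(3)[OF ph] finite_R by (metis Sup_le_iff card_mono subset_trans)
      moreover have "card {S \<in> P. r \<notin> mt y S} \<le> card P"
        using phase_parts[OF ph] by (intro card_mono) auto
      ultimately have "(t' - t) * ?n \<le> (t' - t) * real (card R)"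
        using tt by (intro mult_left_mono) auto
      then show ?thesis using phase.IH dv 1 tt T by (simp add: algebra_simps)
    next
      case 2
      have "(t' - t) * ?n \<le> (t' - t) * real k"
        using few[OF phase.hyps(1) ph 2(1)] tt by (intro mult_left_mono) auto
      then show ?thesis using phase.IH dv 2 tt T by (simp add: algebra_simps)
    next
      case 3
      then have "?n = 0" using none[OF phase.hyps(1) ph] by (simp only: card.empty of_nat_0)
      then show ?thesis using phase.IH dv 3 tt T by simp
    qed
  qed
  also have "\<dots> \<le> real (card R) * T + real k * 1"
    using T by (intro add_mono mult_left_mono) auto
  finally show ?thesis by simp
qed

end


section \<open>Zigzag paths\<close>

text \<open>
  The vertices outside R lie on zigzag paths.  A valley or ridge belongs to a base terminal b
  and an owner x.  Valley l is joined directly to b, which gets there at time foot N l; the owner, who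
  comes along the path, gets to valley l and ridge l at time meet N l.  The arc from a valley to the
  next ridge is twice as long as the one from a ridge to the next valley, but is made tight by b
  alone, so that x passes it in no time.
\<close>

datatype 'a kind = Terminal | Valley 'a 'a nat | Ridge 'a 'a nat

text \<open>The time an owner needs per level, so that \<open>N\<close> levels take time 1/12. It is
  also the unit of cost along a zigzag.\<close>

definition gap :: "nat \<Rightarrow> real" where
  "gap N = 1 / (12 * real N)"

definition foot :: "nat \<Rightarrow> nat \<Rightarrow> real" where
  "foot N l = 1 / 2 + real l * gap N"

definition meet :: "nat \<Rightarrow> nat \<Rightarrow> real" where
  "meet N l = 1 / 2 + (real l + 2) * gap N"

text \<open>The owner may change only on the arc to level \<open>N\<close>; there the zigzags of
  different terminals are strung together.\<close>

inductive zigzag_edge :: "('a \<Rightarrow> 'a kind) \<Rightarrow> nat \<Rightarrow> 'a \<Rightarrow> 'a \<Rightarrow> real \<Rightarrow> bool" for kind N where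
  direct: "kind x = Terminal \<Longrightarrow> kind y = Terminal \<Longrightarrow> zigzag_edge kind N x y 1"
| foot: "kind b = Terminal \<Longrightarrow> kind v = Valley b x l \<Longrightarrow> zigzag_edge kind N b v (foot N l)"
| enter: "kind x = Terminal \<Longrightarrow> kind v = Valley b x 0 \<Longrightarrow> zigzag_edge kind N x v (meet N 0)"
| up: "kind v = Valley b x l \<Longrightarrow> kind w = Ridge b x l \<Longrightarrow> zigzag_edge kind N v w (2 * gap N)"
| down: "kind w = Ridge b x l \<Longrightarrow> kind v = Valley b x' (Suc l) \<Longrightarrow> x' = x \<or> Suc l = N \<Longrightarrow>
    zigzag_edge kind N w v (gap N)"

text \<open>The timing of a zigzag. Starting from valley \<open>l\<close>, or from valley
  \<open>l + 1\<close>, the base has made the arc to ridge \<open>l\<close> tight at the very moment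
  when the owner can use it; the owner then needs one \<open>gap N\<close> to the next
  valley.\<close>

lemma meet_eq: "meet N l = foot N l + 2 * gap N" "meet N l = foot N (Suc l) + gap N"
  "meet N (Suc l) = meet N l + gap N"
  by (simp_all add: meet_def foot_def algebra_simps)

lemma foot_ge: "1 / 2 \<le> foot N l" and meet_ge: "1 / 2 \<le> meet N l" and gap_nonneg: "0 \<le> gap N"
  by (auto simp: foot_def meet_def gap_def)

lemma gap_pos: "0 < N \<Longrightarrow> 0 < gap N"
  by (simp add: gap_def)

lemma foot_top: "0 < N \<Longrightarrow> foot N N = 7 / 12"
  by (simp add: foot_def gap_def)

lemma meet_top: "0 < N \<Longrightarrow> meet N N = 7 / 12 + 2 * gap N"
  by (simp add: meet_eq(1) foot_top)

lemma meet_top_le: "0 < N \<Longrightarrow> meet N N \<le> 3 / 4"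
  by (simp add: meet_top gap_def field_simps)

text \<open>A step between two top valleys next to the same last ridge of \<open>a\<close>. The base
  makes the arc from \<open>e\<close> to the ridge tight, and \<open>a\<close> the one from the
  ridge to \<open>e'\<close>.\<close>

definition bridges :: "('a \<Rightarrow> 'a kind) \<Rightarrow> nat \<Rightarrow> 'a set set \<Rightarrow> 'a \<Rightarrow> 'a \<Rightarrow> ('a \<times> 'a) set" where
  "bridges kind N E b a = {(e, e'). \<exists>w x x'. kind w = Ridge b a (N - 1) \<and> kind e = Valley b x N \<and>
     kind e' = Valley b x' N \<and> {w, e} \<in> E \<and> {w, e'} \<in> E}"

text \<open>Which terminals are still apart depends on the merge plan, so \<open>gadget\<close> asks
  for a common vertex \<open>h\<close> for every base and every choice of \<open>K\<close> other
  terminals, of which \<open>a\<close> is one and \<open>D\<close> the rest.\<close>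

locale zigzag = moat_growing V E c R M
  for V :: "'a set" and E c R M +
  fixes kind :: "'a \<Rightarrow> 'a kind" and N K :: nat
  assumes N_pos: "0 < N" and K_ge: "6 \<le> K"
    and kind_R: "\<And>v. v \<in> V \<Longrightarrow> kind v = Terminal \<longleftrightarrow> v \<in> R"
    and edge: "\<And>u v. {u, v} \<in> E \<Longrightarrow> zigzag_edge kind N u v (c {u, v}) \<or> zigzag_edge kind N v u (c {u, v})"
    and direct_edge: "\<And>x y. x \<in> R \<Longrightarrow> y \<in> R \<Longrightarrow> x \<noteq> y \<Longrightarrow> {x, y} \<in> E"
    and valley: "\<And>v b x l. v \<in> V \<Longrightarrow> kind v = Valley b x l \<Longrightarrow> b \<in> R \<and> b \<noteq> x \<and> l \<le> N \<and> {b, v} \<in> E"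
    and ridge: "\<And>w b x l. w \<in> V \<Longrightarrow> kind w = Ridge b x l \<Longrightarrow> x \<in> R \<and> l < N \<and>
      (\<exists>v. kind v = Valley b x l \<and> {v, w} \<in> E \<and> (l = 0 \<longrightarrow> {x, v} \<in> E) \<and>
        (\<forall>k. l = Suc k \<longrightarrow> (\<exists>w'. kind w' = Ridge b x k \<and> {w', v} \<in> E)))"
    and gadget: "\<And>b a D. b \<in> R \<Longrightarrow> a \<in> R \<Longrightarrow> D \<subseteq> R \<Longrightarrow> b \<noteq> a \<Longrightarrow> b \<notin> D \<Longrightarrow> a \<notin> D \<Longrightarrow> Suc (card D) = K \<Longrightarrow>
      \<exists>h x. kind h = Valley b x N \<and> (\<exists>w. kind w = Ridge b a (N - 1) \<and> {w, h} \<in> E) \<and>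
        (\<forall>d\<in>D. \<exists>w e x'. kind w = Ridge b d (N - 1) \<and> kind e = Valley b x' N \<and> {w, e} \<in> E \<and>
          (e, h) \<in> (bridges kind N E b a)\<^sup>*)"
begin

section \<open>Costs of the edges, read off from the kinds\<close>

lemma edge_V: "{u, v} \<in> E \<Longrightarrow> u \<in> V \<and> v \<in> V"
  using edge_sub by blast

lemma direct_cost: "{x, y} \<in> E \<Longrightarrow> kind x = Terminal \<Longrightarrow> kind y = Terminal \<Longrightarrow> c {x, y} = 1"
  using edge[of x y] by (auto elim!: zigzag_edge.cases)

lemma terminal_kind: "x \<in> R \<Longrightarrow> kind x = Terminal"
  using kind_R R_sub by blast

lemma foot_cost: "{b, v} \<in> E \<Longrightarrow> kind v = Valley b x l \<Longrightarrow> c {b, v} = foot N l"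
  using edge[of b v] valley[of v b x l] edge_V terminal_kind[of b] by (auto elim!: zigzag_edge.cases)

lemma enter_cost: "{x, v} \<in> E \<Longrightarrow> kind v = Valley b x 0 \<Longrightarrow> x \<in> R \<Longrightarrow> c {x, v} = meet N 0"
  using edge[of x v] valley[of v b x 0] edge_V terminal_kind[of x] by (auto elim!: zigzag_edge.cases)

lemma up_cost: "{v, w} \<in> E \<Longrightarrow> kind v = Valley b x l \<Longrightarrow> kind w = Ridge b x l \<Longrightarrow> c {v, w} = 2 * gap N"
  using edge[of v w] by (auto elim!: zigzag_edge.cases)

lemma down_cost: "{w, v} \<in> E \<Longrightarrow> kind w = Ridge b x l \<Longrightarrow> kind v = Valley b x' (Suc l) \<Longrightarrow> c {w, v} = gap N"
  using edge[of w v] by (auto elim!: zigzag_edge.cases)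

text \<open>An upper bound on the moat of \<open>S\<close> at time \<open>t\<close>, valid for every
  merge plan before \<open>meet N N\<close>. From then on a top valley can also be reached by
  terminals other than its base and its owner.\<close>

definition allowed :: "'a set \<Rightarrow> real \<Rightarrow> 'a \<Rightarrow> bool" where
  "allowed S t v \<longleftrightarrow> (case kind v of
     Terminal \<Rightarrow> v \<in> S
   | Valley b x l \<Rightarrow> b \<in> S \<and> foot N l \<le> t \<or> x \<in> S \<and> meet N l \<le> t
   | Ridge b x l \<Rightarrow> (b \<in> S \<or> x \<in> S) \<and> meet N l \<le> t)"

definition push_start :: "'a \<Rightarrow> real" where
  "push_start u = (case kind u of Terminal \<Rightarrow> 0 | Valley b x l \<Rightarrow> foot N l | Ridge b x l \<Rightarrow> meet N l)"

text \<open>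
  Until time meet N N, and whatever has been merged, no arc can be pushed before its start
  time, and at most one part at a time pushes it until it is tight.
\<close>

definition load_bounded :: "real \<Rightarrow> ('a set \<Rightarrow> real) \<Rightarrow> bool" where
  "load_bounded t y \<longleftrightarrow> (\<forall>u v. (u, v) \<in> arcs E \<longrightarrow> t \<le> meet N N \<longrightarrow> t \<le> push_start u + c {u, v} \<longrightarrow>
     ld y (u, v) \<le> max 0 (t - push_start u))"

lemma foot_le_meet: "l \<le> l' \<Longrightarrow> foot N l \<le> meet N l'"
  using gap_nonneg[of N] by (auto simp: foot_def meet_def intro!: mult_right_mono)

text \<open>By the load bound an arc cannot be tight before \<open>push_start u + c {u, v}\<close>.
  In each case this is late enough for the head to be allowed, or beyond the time
  considered.\<close>

lemma allowed_closed:
  assumes lb: "load_bounded t y" and t: "t < meet N N" and uv: "(u, v) \<in> tight y" and al: "allowed S t u"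
  shows "allowed S t v"
proof -
  have e: "{u, v} \<in> E" using uv by (simp add: tight_iff arcs_def)
  have ge: "push_start u + c {u, v} \<le> t"
  proof (rule ccontr)
    assume "\<not> ?thesis"
    then have lt: "t - push_start u < c {u, v}" by simp
    then have "ld y (u, v) \<le> max 0 (t - push_start u)"
      using lb t uv unfolding load_bounded_def tight_iff by force
    with lt have "ld y (u, v) < c {u, v}" using c_pos[OF e] by simp
    then show False using uv c_pos[OF e] by (simp add: tight_iff)
  qed
  have t1: "t < 1" using t meet_top_le[OF N_pos] by simp
  from edge[OF e] show ?thesis
  proof
    assume "zigzag_edge kind N u v (c {u, v})"
    then show ?thesis
    proof cases
      case direct
      then show ?thesis using ge t1 by (simp add: push_start_def)
    next
      case (foot x l)
      then show ?thesis using ge al by (simp add: push_start_def allowed_def)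
    next
      case (enter b)
      then show ?thesis using ge al by (simp add: push_start_def allowed_def)
    next
      case (up b x l)
      then show ?thesis using ge al by (auto simp: push_start_def allowed_def meet_eq(1))
    next
      case (down b x l x')
      \<comment> \<open>If the owner changes here, then \<open>Suc l = N\<close>, and this
        contradicts \<open>t < meet N N\<close>.\<close>
      then have "meet N (Suc l) \<le> t" using ge by (simp add: push_start_def meet_eq(3))
      then show ?thesis using down ge al t foot_le_meet[of "Suc l" "Suc l"] by (auto simp: push_start_def allowed_def)
    qed
  next
    assume "zigzag_edge kind N v u (c {u, v})"
    then show ?thesis
    proof cases
      case direct
      then show ?thesis using ge t1 by (simp add: push_start_def)
    next
      case (foot x l)
      then show ?thesis using ge t1 foot_ge[of N l] by (simp add: push_start_def)
    next
      case (enter b)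
      then show ?thesis using ge t1 foot_ge[of N 0] meet_ge[of N 0] by (simp add: push_start_def)
    next
      case (up b x l)
      then show ?thesis using ge al gap_nonneg[of N] foot_le_meet[of l l] by (auto simp: push_start_def allowed_def)
    next
      case (down b x l x')
      then have "meet N l \<le> t" using ge by (simp add: push_start_def meet_eq(2))
      then show ?thesis using down al t by (auto simp: allowed_def)
    qed
  qed
qed

lemma moat_allowed:
  assumes lb: "load_bounded t y" and t: "0 \<le> t" "t < meet N N" and S: "S \<subseteq> R" and v: "v \<in> mt y S"
  shows "allowed S t v"
proof -
  obtain x where x: "x \<in> S" "(x, v) \<in> (tight y)\<^sup>*" using v by (auto simp: moat_def)
  from x(2) show ?thesis
  proof (induction rule: rtrancl_induct)
    case base
    then show ?case using x S terminal_kind[of x] by (auto simp: allowed_def)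
  next
    case (step u v)
    then show ?case using allowed_closed[OF lb t(2)] by blast
  qed
qed

lemma base_reached:
  assumes run: "run V E c M B t y" and v: "v \<in> V" "kind v = Valley b x l" and t: "foot N l \<le> t"
  shows "reached t y b v"
proof -
  have "b \<in> R" "{b, v} \<in> E" using valley[OF v] by auto
  then show ?thesis
    using reached_arc[OF run, of 0 b v b] reached_refl foot_cost[of b v] v(2) t by (simp add: arcs_def)
qed

text \<open>Outside \<open>R\<close> only the base and the owner can bring a part to the tail. One
  of them is excluded: it has not arrived at the tail yet, or its part already holds the head. So
  all pushing parts share a fixed terminal, and parts are disjoint.\<close>

lemma pushing_bound:
  assumes run: "run V E c M B t y" and lb: "load_bounded t y" and ph: "is_phase t y t' P"
    and t: "t < meet N N" "t < push_start u + c {u, v}" and a: "(u, v) \<in> arcs E"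
  shows "card (pushing y P u v) \<le> (if t < push_start u then 0 else 1)"
proof -
  have e: "{u, v} \<in> E" using a by (simp add: arcs_def)
  have t0: "0 \<le> t" using run run_nonneg by blast
  have push: "S \<subseteq> R" "allowed S t u" if "S \<in> pushing y P u v" for S
    using that phase_parts(3)[OF ph] moat_allowed[OF lb t0 t(1)] by (auto simp: pushing_def)
  have nobase: "b \<notin> S" if "S \<in> pushing y P u v" "kind v = Valley b x l" "foot N l \<le> t" for S b x l
    using that base_reached[OF run _ that(2,3)] edge_V[OF e] phase_reachedD[OF _ ph]
    by (auto simp: pushing_def)
  have notin: "v \<notin> S" if "S \<in> pushing y P u v" for S
    using that subset_moat[of S V E c y] by (auto simp: pushing_def)
  have one: "card (pushing y P u v) \<le> (if t < push_start u then 0 else 1)"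
    if p: "\<And>S. S \<in> pushing y P u v \<Longrightarrow> p \<in> S" for p
  proof (cases "t < push_start u")
    case True
    then have "pushing y P u v = {}"
      using push t0 gap_nonneg[of N] by (force simp: push_start_def allowed_def meet_eq(1) split: kind.splits)
    then show ?thesis by simp
  qed (use card_pushing_le_1[OF ph p] in simp)
  from edge[OF e] show ?thesis
  proof
    assume "zigzag_edge kind N u v (c {u, v})"
    then show ?thesis
    proof cases
      case direct
      then show ?thesis using push by (intro one[of u]) (auto simp: allowed_def)
    next
      case (foot x l)
      then show ?thesis using push by (intro one[of u]) (auto simp: allowed_def)
    next
      case (enter b)
      then show ?thesis using push by (intro one[of u]) (auto simp: allowed_def)
    next
      case (up b x l)
      then show ?thesis using push t by (intro one[of b]) (auto simp: allowed_def push_start_def meet_eq(1))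
    next
      case (down b x l x')
      have "x \<in> S" if "S \<in> pushing y P u v" for S
      proof -
        have "meet N l \<le> t" "b \<in> S \<or> x \<in> S" using push(2)[OF that] down by (auto simp: allowed_def)
        then show ?thesis using nobase[OF that down(3)] meet_eq(2)[of N l] gap_nonneg[of N] by auto
      qed
      then show ?thesis by (rule one)
    qed
  next
    assume "zigzag_edge kind N v u (c {u, v})"
    then show ?thesis
    proof cases
      case direct
      then show ?thesis using push by (intro one[of u]) (auto simp: allowed_def)
    next
      case (foot x l)
      then show ?thesis using push notin by (intro one[of x]) (auto simp: allowed_def)
    next
      case (enter b)
      then show ?thesis using push notin by (intro one[of b]) (auto simp: allowed_def)
    next
      case (up b x l)
      have "x \<in> S" if "S \<in> pushing y P u v" for S
      proof -
        have "meet N l \<le> t" "b \<in> S \<or> x \<in> S" using push(2)[OF that] up by (auto simp: allowed_def)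
        then show ?thesis using nobase[OF that up(2)] foot_le_meet[of l l] by auto
      qed
      then show ?thesis by (rule one)
    next
      case (down b x l x')
      then show ?thesis using push t gap_nonneg[of N]
        by (intro one[of b]) (auto simp: allowed_def push_start_def meet_eq(1))
    qed
  qed
qed

lemma run_load_bounded:
  assumes "run V E c M B t y"
  shows "load_bounded t y"
  using assms
proof (induction rule: run_induct)
  case start
  show ?case by (simp add: load_bounded_def load_zero)
next
  case (phase t y t' P)
  show ?case unfolding load_bounded_def
  proof (intro allI impI)
    fix u v assume a: "(u, v) \<in> arcs E" and t': "t' \<le> meet N N" "t' \<le> push_start u + c {u, v}"
    have tt: "t < t'" using phase.hyps(2) by (simp add: is_phase_def)
    have le: "ld y (u, v) \<le> max 0 (t - push_start u)"
      using phase.IH a t' tt by (simp add: load_bounded_def)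
    have "ld (gr P (t' - t) y) (u, v) \<le> ld y (u, v) + (t' - t) * real (if t < push_start u then 0 else 1)"
      using load_phase_le[OF phase.hyps(2) a pushing_bound[OF phase.hyps(1) phase.IH phase.hyps(2) _ _ a]] t' tt
      by simp
    then show "ld (gr P (t' - t) y) (u, v) \<le> max 0 (t' - push_start u)"
      using le tt by (auto split: if_splits)
  qed
qed

lemma phase_allowed:
  assumes "run V E c M B t y" "is_phase t y t' P" "t < meet N N" "S \<in> P" "v \<in> mt y S"
  shows "allowed S t v"
  using moat_allowed[OF run_load_bounded[OF assms(1)] run_nonneg[OF assms(1)] assms(3) _ assms(5)]
    phase_parts(3)[OF assms(2,4)] by blast

text \<open>The \<open>foot\<close> and \<open>meet\<close> times delimit the periods of pushing in
  the lower bounds on loads; the last two times delimit the periods of growth of the dual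
  value.\<close>

definition breaks :: "real set" where
  "breaks = foot N ` {..N} \<union> meet N ` {..N} \<union> {meet N N + 1 / real K, 1}"

lemma meet_breaks: "l \<le> N \<Longrightarrow> meet N l \<in> breaks"
  by (auto simp: breaks_def)

lemma finite_breaks: "finite breaks"
  by (simp add: breaks_def)

abbreviation "zrun \<equiv> run V E c M breaks"

text \<open>Serves both the arc from valley \<open>l\<close> up to ridge \<open>l\<close> and the
  one from valley \<open>l' + 1\<close> back to ridge \<open>l'\<close>; the equation for
  \<open>c {u, v}\<close> covers both. The base pushes all the time, because before
  \<open>meet N l'\<close> no part whatsoever holds ridge \<open>l'\<close>.\<close>

lemma base_makes_tight:
  assumes run: "zrun t y" and a: "(u, v) \<in> arcs E" and u: "kind u = Valley b x l" and v: "kind v = Ridge b x' l'"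
    and c: "meet N l' = foot N l + c {u, v}" and l: "l' < N" and t: "meet N l' \<le> t"
  shows "(u, v) \<in> tight y"
proof -
  have V: "u \<in> V" "v \<in> V" using a arc_V by auto
  have b: "b \<in> R" "l \<le> N" using valley[OF V(1) u] by auto
  have le: "foot N l \<le> meet N l'" using c c_pos a by (simp add: arcs_def less_imp_le)
  have less: "meet N l' \<le> meet N N"
    using l gap_nonneg[of N] by (auto simp: meet_def intro!: mult_right_mono)
  have "real 1 * (min t (meet N l') - foot N l) \<le> ld y (u, v)"
  proof (rule load_lower[where Q = "\<lambda>_ _. True", OF run _ _ _ _ _ a])
    fix s y s' P
    assume run: "zrun s y" and ph: "is_phase s y s' P" and s: "foot N l \<le> s" "s < meet N l'"
    have "card {b} \<le> card (pushing y P u v)"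
    proof (rule card_pushing_ge[OF ph])
      fix x S assume "x \<in> {b}" "S \<in> P" "x \<in> S"
      moreover have "u \<in> mt y S" if "S \<in> P" "b \<in> S" for S
        using phase_reachedD[OF base_reached[OF run V(1) u s(1)] ph that] .
      moreover have "v \<notin> mt y S" if "S \<in> P" for S
        using phase_allowed[OF run ph _ that, of v] s less v by (auto simp: allowed_def)
      ultimately show "u \<in> mt y S \<and> v \<notin> mt y S" by simp
    qed (use b in auto)
    then show "1 \<le> card (pushing y P u v)" by simp
  qed (use t le foot_ge[of N l] b l in \<open>auto simp: breaks_def\<close>)
  then show ?thesis using load_ge_tight[OF run a] c t by simp
qed

text \<open>Induction along the zigzag: the owner pays for the arc to the next valley only, and on
  arrival there the base has just made the arc to the ridge tight.\<close>

lemma ridge_reached: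
  assumes "kind w = Ridge b x l" "w \<in> V" "zrun t y" "meet N l \<le> t"
  shows "reached t y x w"
  using assms
proof (induction l arbitrary: w t y)
  case 0
  obtain v where v: "kind v = Valley b x 0" "{v, w} \<in> E" "{x, v} \<in> E" and xR: "x \<in> R"
    using ridge[OF 0(2,1)] by auto
  have "reached t y x v"
    using reached_arc[OF 0(3), of 0 x v x] reached_refl enter_cost[OF v(3,1) xR] 0(4) xR v(3)
    by (simp add: arcs_def)
  moreover have "(v, w) \<in> tight y"
    using base_makes_tight[OF 0(3) _ v(1) 0(1) _ N_pos 0(4)] up_cost[OF v(2,1) 0(1)] v(2)
    by (simp add: arcs_def meet_eq(1))
  ultimately show ?case by (rule reached_tight)
next
  case (Suc l)
  obtain v w' where v: "kind v = Valley b x (Suc l)" "{v, w} \<in> E" "kind w' = Ridge b x l" "{w', v} \<in> E"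
    and xR: "x \<in> R" "Suc l < N"
    using ridge[OF Suc.prems(2,1)] by auto
  have w': "w' \<in> V" using edge_V[OF v(4)] by simp
  have a: "(w', v) \<in> arcs E" "(v, w) \<in> arcs E" using v by (auto simp: arcs_def)
  have "reached t y x v"
    using reached_arc[OF Suc.prems(3), of "meet N l" w' v x] Suc.IH[OF v(3) w'] down_cost[OF v(4,3,1)]
      Suc.prems(4) xR a meet_ge[of N l] by (simp add: breaks_def meet_eq(3))
  moreover have "(v, w) \<in> tight y"
    using base_makes_tight[OF Suc.prems(3) a(2) v(1) Suc.prems(1) _ xR(2) Suc.prems(4)] up_cost[OF v(2,1) Suc.prems(1)]
    by (simp add: meet_eq(1))
  ultimately show ?case by (rule reached_tight)
qed

section \<open>Terminals that are still apart\<close>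

definition separate_at :: "real \<Rightarrow> 'a \<Rightarrow> 'a \<Rightarrow> bool" where
  "separate_at s x y \<longleftrightarrow> (\<forall>S\<in>M s. \<not> (x \<in> S \<and> y \<in> S))"

text \<open>Parts only get coarser, so terminals apart at \<open>s\<close> were apart in every phase
  up to \<open>s\<close>. This lets the present situation be used in arguments about past
  loads.\<close>

lemma phase_separate:
  assumes "is_phase t y t' P" "t' \<le> s" "separate_at s x z" "S \<in> P" "x \<in> S" "z \<in> S"
  shows False
proof -
  have t': "0 \<le> t'" "S \<in> M t'" using assms(1,4) phase_parts(1)[OF assms(1)] by (auto simp: is_phase_def)
  then obtain S' where S': "S' \<in> M s" "x \<in> S'"
    using part_ex[of s x] part_sub[of t' S] assms(2,5) by auto
  then have "S \<subseteq> S'" using coarsening[of t' s S S' x] t' assms by simp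
  then show False using assms S' by (auto simp: separate_at_def)
qed

text \<open>A part without \<open>b\<close> cannot hold the top valley \<open>e\<close> before
  \<open>meet N N\<close>. So the part of \<open>a\<close> pushes the arc from
  \<open>meet N (N - 1)\<close> on, for exactly \<open>gap N\<close>. If it contained
  \<open>b\<close>, it would hold \<open>e\<close> already and not push.\<close>

lemma connector_tight:
  assumes run: "zrun t y" and e: "{w, e} \<in> E" and w: "kind w = Ridge b a (N - 1)" and e': "kind e = Valley b x N"
    and sep: "separate_at s a b" and t: "meet N N \<le> t" "t \<le> s"
  shows "(w, e) \<in> tight y"
proof -
  have V: "w \<in> V" "e \<in> V" using edge_V[OF e] by auto
  have a: "(w, e) \<in> arcs E" using e by (simp add: arcs_def)
  have N: "Suc (N - 1) = N" using N_pos by simp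
  have eq: "meet N N = meet N (N - 1) + gap N" using meet_eq(3)[of N "N - 1"] N by simp
  have c: "c {w, e} = gap N" using down_cost[OF e w, of x] e' N by simp
  have "real 1 * (min t (meet N N) - meet N (N - 1)) \<le> ld y (w, e)"
  proof (rule load_lower[where Q = "\<lambda>t _. t \<le> s", OF run _ _ _ _ _ a])
    fix t y t' P
    assume run: "zrun t y" and ph: "is_phase t y t' P" and t: "meet N (N - 1) \<le> t" "t < meet N N" and t': "t' \<le> s"
    have "card {a} \<le> card (pushing y P w e)"
    proof (rule card_pushing_ge[OF ph])
      fix z S assume z: "z \<in> {a}" "S \<in> P" "z \<in> S"
      have "w \<in> mt y S"
        using phase_reachedD[OF ridge_reached[OF w V(1) run t(1)] ph] z by simp
      moreover have "b \<notin> S" using phase_separate[OF ph t' sep] z by auto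
      then have "e \<notin> mt y S"
        using phase_allowed[OF run ph t(2) z(2), of e] e' t by (auto simp: allowed_def)
      ultimately show "w \<in> mt y S \<and> e \<notin> mt y S" by simp
    qed (use ridge[OF V(1) w] in auto)
    then show "1 \<le> card (pushing y P w e)" by simp
  qed (use t meet_breaks[of N] meet_breaks[of "N - 1"] eq gap_nonneg[of N] meet_ge[of N "N - 1"] in
      \<open>auto simp: is_phase_def simp del: One_nat_def\<close>)
  then show ?thesis using load_ge_tight[OF run a] c t eq by simp
qed

lemma bridge_reached:
  assumes run: "zrun t y" and sep: "separate_at s a b" and t: "meet N N \<le> t" "t \<le> s" and z: "reached t y z e"
    and ee': "(e, e') \<in> bridges kind N E b a"
  shows "reached t y z e'"
proof -
  obtain w x x' where w: "kind w = Ridge b a (N - 1)" and e: "kind e = Valley b x N" "kind e' = Valley b x' N"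
      "{w, e} \<in> E" "{w, e'} \<in> E"
    using ee' by (auto simp: bridges_def)
  have N: "Suc (N - 1) = N" using N_pos by simp
  have ew: "(e, w) \<in> arcs E" "{e, w} = {w, e}" using e by (auto simp: arcs_def insert_commute)
  have eq: "meet N (N - 1) = foot N N + gap N" using meet_eq(2)[of N "N - 1"] N by simp
  have "c {w, e} = gap N" using down_cost[OF e(3) w, of x] e(1) N by simp
  moreover have "meet N (N - 1) \<le> t" using t meet_eq(3)[of N "N - 1"] N gap_nonneg[of N] by simp
  ultimately have "(e, w) \<in> tight y"
    using base_makes_tight[OF run ew(1) e(1) w] eq N_pos ew(2) by simp
  then have "reached t y z w" using z reached_tight by blast
  then show ?thesis using connector_tight[OF run e(4) w e(2) sep t] reached_tight by blast
qed

text \<open>Otherwise there are \<open>K\<close> terminals in different parts that miss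
  \<open>r\<close>; take their gadget with base \<open>r\<close>. From \<open>meet N N\<close> on
  all of them hold its common vertex \<open>h\<close>, and \<open>K\<close> different parts push the
  arc from \<open>h\<close> to \<open>r\<close>. In time \<open>1 / real K\<close> this gives load
  1, more than its cost 7/12.\<close>

lemma few_apart:
  assumes run: "zrun t y" and ph: "is_phase t y t' P" and t: "meet N N + 1 / real K \<le> t" and r: "r \<in> R"
  shows "card {S \<in> P. r \<notin> mt y S} \<le> K"
proof (rule ccontr)
  let ?P = "{S \<in> P. r \<notin> mt y S}"
  assume "\<not> card ?P \<le> K"
  then have many: "K \<le> card ?P" by simp
  have t': "0 \<le> t'" "t < t'" "M t' = P" using ph phase_parts(1)[OF ph] by (auto simp: is_phase_def)
  obtain X0 where X0: "X0 \<subseteq> \<Union>?P" "card X0 = card ?P"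
    and sep0: "\<And>x x' S. x \<in> X0 \<Longrightarrow> x' \<in> X0 \<Longrightarrow> S \<in> M t' \<Longrightarrow> x \<in> S \<Longrightarrow> x' \<in> S \<Longrightarrow> x = x'"
    by (rule card_part_le[of t' ?P]) (use t' in auto)
  obtain X where X: "X \<subseteq> X0" "card X = K" using many X0(2) by (metis obtain_subset_with_card_n)
  have XR: "X \<subseteq> R" using X X0 phase_parts(3)[OF ph] by blast
  have rX: "r \<notin> mt y S" if x: "x \<in> X" "S \<in> P" "x \<in> S" for x S
  proof -
    obtain S' where "S' \<in> P" "r \<notin> mt y S'" "x \<in> S'" using x X X0 by blast
    then show ?thesis using phase_unique[OF ph, of S S' x] x by simp
  qed
  have K_pos: "0 < K" using K_ge by simp
  then obtain a where a: "a \<in> X" using X by fastforce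
  define D where "D = X - {a}"
  have D: "Suc (card D) = K" "D \<subseteq> R" "a \<notin> D"
    using X a XR K_pos finite_subset[OF XR finite_R] by (auto simp: D_def card_Diff_singleton)
  have rnX: "r \<notin> X"
  proof
    assume rx: "r \<in> X"
    obtain S where "S \<in> P" "r \<in> S" using phase_part_ex[OF ph r] by blast
    then show False using rX[OF rx] subset_moat[of S V E c y] by blast
  qed
  have sep: "separate_at t' x x'" if "x \<in> X" "x' \<in> X" "x \<noteq> x'" for x x'
    unfolding separate_at_def using that X(1) sep0 by blast
  have sep_r: "separate_at t' x r" if "x \<in> X" for x
    unfolding separate_at_def
  proof (intro ballI notI)
    fix S assume S: "S \<in> M t'" "x \<in> S \<and> r \<in> S"
    then have "r \<notin> mt y S" using rX[OF that] t' by simp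
    then show False using S subset_moat[of S V E c y] by blast
  qed
  have aR: "a \<in> R" and ra: "r \<noteq> a" and rD: "r \<notin> D" using a XR rnX by (auto simp: D_def)
  obtain h z where h: "kind h = Valley r z N" "\<exists>w. kind w = Ridge r a (N - 1) \<and> {w, h} \<in> E"
    and hD: "\<And>d. d \<in> D \<Longrightarrow> \<exists>w e x'. kind w = Ridge r d (N - 1) \<and> kind e = Valley r x' N \<and> {w, e} \<in> E \<and>
          (e, h) \<in> (bridges kind N E r a)\<^sup>*"
    using gadget[OF r aR D(2) ra rD D(3) D(1)] by blast
  have eqN: "meet N N = meet N (N - 1) + gap N" using meet_eq(3)[of N "N - 1"] N_pos by simp
  have hub: "reached s y x h" if run: "zrun s y" and s: "meet N N \<le> s" "s \<le> t'" and x: "x \<in> X" for s y x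
  proof -
    have le: "meet N (N - 1) \<le> s" using s eqN gap_nonneg[of N] by simp
    show ?thesis
    proof (cases "x = a")
      case True
      obtain w where w: "kind w = Ridge r a (N - 1)" "{w, h} \<in> E" using h by blast
      have "reached s y a w" using ridge_reached[OF w(1) _ run le] edge_V[OF w(2)] by simp
      then show ?thesis
        using connector_tight[OF run w(2,1) h(1) sep_r[OF a] s] reached_tight True by blast
    next
      case False
      then obtain w e x' where w: "kind w = Ridge r x (N - 1)" "kind e = Valley r x' N" "{w, e} \<in> E"
        and eh: "(e, h) \<in> (bridges kind N E r a)\<^sup>*"
        using hD[of x] x by (auto simp: D_def)
      have "reached s y x w" using ridge_reached[OF w(1) _ run le] edge_V[OF w(3)] by simp
      then have "reached s y x e"
        using connector_tight[OF run w(3,1,2) sep_r[OF x] s] reached_tight by blast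
      with eh show ?thesis
      proof (induction rule: rtrancl_induct)
        case (step e e')
        then show ?case using bridge_reached[OF run sep_r[OF a] s] by blast
      qed
    qed
  qed
  have hV: "h \<in> V" using h edge_V by blast
  have hr: "(h, r) \<in> arcs E" "c {h, r} = foot N N"
    using valley[OF hV h(1)] foot_cost[OF _ h(1)] by (auto simp: arcs_def insert_commute)
  \<comment> \<open>The parts are those of the final phase, while \<open>y\<close> may be an earlier
    vector. The property passes to earlier states because tight arcs stay tight, so moats only
    grow.\<close>
  let ?Q = "\<lambda>s y. s \<le> t \<and> (\<forall>x\<in>X. \<forall>S\<in>P. x \<in> S \<longrightarrow> r \<notin> mt y S)"
  have "real K * (min t t - meet N N) \<le> ld y (h, r)"
  proof (rule load_lower[where Q = ?Q, OF run _ _ _ _ _ hr(1)])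
    fix s y s' P'
    assume run: "zrun s y" and ph': "is_phase s y s' P'" and s: "meet N N \<le> s" "s < t"
      and Q: "?Q s' (gr P' (s' - s) y)"
    have s': "0 \<le> s'" "M s' = P'" "s' \<le> t'" using ph' phase_parts(1)[OF ph'] Q t' by (auto simp: is_phase_def)
    have "card X \<le> card (pushing y P' h r)"
    proof (rule card_pushing_ge[OF ph' XR])
      fix x S assume x: "x \<in> X" "S \<in> P'" "x \<in> S"
      have "h \<in> mt y S"
        using phase_reachedD[OF hub[OF run s(1) _ x(1)] ph' x(2,3)] s t' by simp
      moreover obtain S' where S': "S' \<in> P" "x \<in> S'" using phase_part_ex[OF ph, of x] x XR by blast
      have "S \<subseteq> S'" using coarsening[of s' t' S S' x] s' S' t' x by simp
      then have "mt y S \<subseteq> mt (gr P' (s' - s) y) S'" by (rule moat_mono[OF tight_phase[OF ph']])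
      then have "r \<notin> mt y S" using Q x S' by blast
      ultimately show "h \<in> mt y S \<and> r \<notin> mt y S" by simp
    next
      fix x x' S assume "x \<in> X" "x' \<in> X" "S \<in> P'" "x \<in> S" "x' \<in> S"
      then show "x = x'" using phase_separate[OF ph' s'(3) sep] by blast
    qed
    then show "K \<le> card (pushing y P' h r)" using X by simp
  next
    fix s y s' P' assume ph': "is_phase s y s' P'" and Q: "?Q s' (gr P' (s' - s) y)"
    have "mt y S \<subseteq> mt (gr P' (s' - s) y) S" for S
      using moat_mono[OF tight_phase[OF ph'] order_refl] .
    then show "?Q s y" using Q ph' by (fastforce simp: is_phase_def)
  next
    have "0 \<le> 1 / real K" by simp
    then show "meet N N \<le> t" using t by linarith
  qed (use rX meet_ge[of N N] in \<open>auto simp: breaks_def\<close>)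
  moreover have "1 \<le> real K * (t - meet N N)"
  proof -
    have "real K * (1 / real K) \<le> real K * (t - meet N N)" using t by (intro mult_left_mono) auto
    then show ?thesis using K_pos by simp
  qed
  ultimately show False using load_le[OF run hr(1)] hr(2) foot_top[OF N_pos] by simp
qed

lemma none_apart:
  assumes run: "run V E c M B t y" and ph: "is_phase t y t' P" and t: "1 \<le> t" and r: "r \<in> R"
  shows "{S \<in> P. r \<notin> mt y S} = {}"
proof -
  have "r \<in> mt y S" if S: "S \<in> P" for S
  proof -
    have "S \<in> M t'" "0 \<le> t'" using S ph phase_parts(1)[OF ph] by (auto simp: is_phase_def)
    then obtain x where x: "x \<in> S" "x \<in> R" using part_ne[of t' S] part_sub[of t' S] by blast
    show ?thesis
    proof (cases "x = r")
      case True
      then show ?thesis using x subset_moat[of S V E c y] by blast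
    next
      case False
      then have "{x, r} \<in> E" using direct_edge x r by blast
      moreover have "c {x, r} = 1" using direct_cost[OF \<open>{x, r} \<in> E\<close>] kind_R x r R_sub by blast
      ultimately have "reached t y x r"
        using reached_arc[OF run, of 0 x r x] reached_refl t x by (simp add: arcs_def)
      then show ?thesis using phase_reachedD ph S x by blast
    qed
  qed
  then show ?thesis by blast
qed

lemma moat_state_value:
  assumes "moat_state V E c M t y" "r \<in> R"
  shows "dual_value V R r y \<le> real (card R) * (7 / 12 + 2 * gap N + 1 / real K) + real K"
proof -
  \<comment> \<open>The few parts that remain must be counted from a time not later than 1: 7/12 +
    2/12 + 1/6 = 11/12.\<close>
  have "1 / real K \<le> 1 / 6" using K_ge by (intro divide_left_mono) auto
  moreover have "meet N N = 7 / 12 + 2 * gap N" using meet_top N_pos by blast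
  moreover have "gap N \<le> 1 / 12" using N_pos by (simp add: gap_def)
  ultimately have "meet N N + 1 / real K \<le> 1" by simp
  then have "dual_value V R r y \<le> real (card R) * (meet N N + 1 / real K) + real K"
    using moat_state_run[OF assms(1) finite_breaks] meet_ge[of N N] assms(2) few_apart none_apart
    by (intro dual_value_le[of breaks t y]) (auto simp: breaks_def add_nonneg_nonneg)
  then show ?thesis using meet_top[OF N_pos] by simp
qed

end


section \<open>The instances\<close>

datatype node = Low "nat list" nat nat nat | High "nat list" nat nat nat | Top "nat list" nat nat

instance node :: countable
  by countable_datatype

text \<open>
  Terminals are the numbers below n.  A gadget is a list b, a, d_0, d_1, ... of terminals; b is the
  base of all its vertices.  For every d_i there are zigzags of a with indices j < 2 N and one zigzag
  of d_i with index 2 N, whose ends are strung together by the vertices Top g i j.  The vertex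
  Top g 0 0 is common to all i.
\<close>

locale construction =
  fixes n N K :: nat
  assumes N_pos: "0 < N" and K_ge: "6 \<le> K" and n_pos: "0 < n"
begin

text \<open>The shift by \<open>n\<close> keeps the numbers below \<open>n\<close> free for the
  terminals.\<close>

definition code :: "node \<Rightarrow> nat" where
  "code x = n + to_nat x"

definition node_of :: "nat \<Rightarrow> node" where
  "node_of v = from_nat (v - n)"

lemma node_of_code [simp]: "node_of (code x) = x" and code_ge [simp]: "\<not> code x < n"
  by (auto simp: node_of_def code_def)

definition owner :: "nat list \<Rightarrow> nat \<Rightarrow> nat \<Rightarrow> nat" where
  "owner g i j = (if j < 2 * N then g ! 1 else g ! (i + 2))"

text \<open>\<open>Suc i < K\<close> keeps \<open>g ! (i + 2)\<close>, the terminal d_i, inside a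
  list of length \<open>Suc K\<close>.\<close>

definition place :: "nat list \<Rightarrow> nat \<Rightarrow> nat \<Rightarrow> bool" where
  "place g i j \<longleftrightarrow> distinct g \<and> length g = Suc K \<and> set g \<subseteq> {..<n} \<and> Suc i < K \<and> j \<le> 2 * N"

definition vertices :: "nat set" where
  "vertices = {..<n} \<union> code ` ({Low g i j l | g i j l. place g i j \<and> l < N} \<union>
     {High g i j l | g i j l. place g i j \<and> l < N} \<union> {Top g i j | g i j. place g i j})"

text \<open>All tops are assigned to a. The zigzag of d_i ends at one of them by the exception for
  level \<open>N\<close> in \<open>zigzag_edge.down\<close>.\<close>

definition kind_of :: "nat \<Rightarrow> nat kind" where
  "kind_of v = (if v < n then Terminal else case node_of v of
     Low g i j l \<Rightarrow> Valley (g ! 0) (owner g i j) l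
   | High g i j l \<Rightarrow> Ridge (g ! 0) (owner g i j) l
   | Top g i j \<Rightarrow> Valley (g ! 0) (g ! 1) N)"

text \<open>Identifies the tops with \<open>j = 0\<close> for all \<open>i\<close>. For
  \<open>i > 0\<close> the vertex \<open>Top g i 0\<close> is left as a leaf at the base.\<close>

definition top_of :: "nat list \<Rightarrow> nat \<Rightarrow> nat \<Rightarrow> node" where
  "top_of g i j = Top g (if j = 0 then 0 else i) j"

inductive link :: "nat \<Rightarrow> nat \<Rightarrow> bool" where
  "x < n \<Longrightarrow> y < n \<Longrightarrow> x \<noteq> y \<Longrightarrow> link x y"
| "place g i j \<Longrightarrow> l < N \<Longrightarrow> link (g ! 0) (code (Low g i j l))"
| "place g i j \<Longrightarrow> link (g ! 0) (code (Top g i j))"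
| "place g i j \<Longrightarrow> link (owner g i j) (code (Low g i j 0))"
| "place g i j \<Longrightarrow> l < N \<Longrightarrow> link (code (Low g i j l)) (code (High g i j l))"
| "place g i j \<Longrightarrow> Suc l < N \<Longrightarrow> link (code (High g i j l)) (code (Low g i j (Suc l)))"
| "place g i j \<Longrightarrow> link (code (High g i j (N - 1))) (code (top_of g i j))"
| "place g i j \<Longrightarrow> j < 2 * N \<Longrightarrow> link (code (High g i j (N - 1))) (code (top_of g i (Suc j)))"

definition edges :: "nat set set" where
  "edges = {{u, v} | u v. link u v}"

text \<open>On edges of the graph the kinds of the ends determine the cost. The choice only
  abstracts from which end comes first in \<open>zigzag_edge\<close>.\<close>

definition cost :: "nat set \<Rightarrow> real" where
  "cost e = (SOME d. \<exists>u v. e = {u, v} \<and> zigzag_edge kind_of N u v d)"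

lemma code_eq_iff [simp]: "code x = code y \<longleftrightarrow> x = y"
  by (simp add: code_def)

lemma place_nth_less: "place g i j \<Longrightarrow> k < Suc K \<Longrightarrow> g ! k < n"
  unfolding place_def by (metis lessThan_iff nth_mem subsetD)

lemma place_nth:
  assumes "place g i j"
  shows "g ! 0 < n" "owner g i j < n" "g ! 0 \<noteq> g ! 1" "g ! 0 \<noteq> owner g i j"
proof -
  have g: "distinct g" "length g = Suc K" "set g \<subseteq> {..<n}" "Suc i < K" using assms by (auto simp: place_def)
  show "g ! 0 < n" "owner g i j < n" using place_nth_less[OF assms] g(4) K_ge by (auto simp: owner_def)
  show "g ! 0 \<noteq> g ! 1" "g ! 0 \<noteq> owner g i j"
    using g K_ge by (auto simp: owner_def nth_eq_iff_index_eq)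
qed

lemma kind_of_simps [simp]:
  "v < n \<Longrightarrow> kind_of v = Terminal"
  "kind_of (code (Low g i j l)) = Valley (g ! 0) (owner g i j) l"
  "kind_of (code (High g i j l)) = Ridge (g ! 0) (owner g i j) l"
  "kind_of (code (Top g i j)) = Valley (g ! 0) (g ! 1) N"
  "kind_of (code (top_of g i j)) = Valley (g ! 0) (g ! 1) N"
  by (simp_all add: kind_of_def top_of_def)

lemma vertices_cases [consumes 1, case_names terminal low high top]:
  assumes "v \<in> vertices"
  obtains "v < n" | g i j l where "v = code (Low g i j l)" "place g i j" "l < N"
  | g i j l where "v = code (High g i j l)" "place g i j" "l < N"
  | g i j where "v = code (Top g i j)" "place g i j"
  using assms by (auto simp: vertices_def)

lemma link_vertices:
  assumes "link u v"
  shows "u \<in> vertices \<and> v \<in> vertices \<and> u \<noteq> v"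
  using assms
proof cases
  case (7 g i j)
  then have "place g (if j = 0 then 0 else i) j" by (auto simp: place_def)
  then show ?thesis using 7 N_pos by (fastforce simp: vertices_def top_of_def)
next
  case (8 g i j)
  then have "place g i (Suc j)" by (auto simp: place_def)
  then show ?thesis using 8 N_pos by (fastforce simp: vertices_def top_of_def)
next
  case (2 g i j l)
  then show ?thesis using place_nth(1)[OF 2(3)] code_ge[of "Low g i j l"] by (auto simp: vertices_def)
next
  case (3 g i j)
  then show ?thesis using place_nth(1)[OF 3(3)] code_ge[of "Top g i j"] by (auto simp: vertices_def)
next
  case (4 g i j)
  then show ?thesis using place_nth(2)[OF 4(3)] code_ge[of "Low g i j 0"] N_pos by (auto simp: vertices_def)
qed (auto simp: vertices_def)

lemma link_zigzag_edge:
  assumes "link u v"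
  shows "\<exists>d. zigzag_edge kind_of N u v d"
  using assms
proof cases
  case 1
  then show ?thesis using zigzag_edge.direct[of kind_of u v N] by auto
next
  case (2 g i j l)
  then show ?thesis using zigzag_edge.foot[of kind_of u v] place_nth by fastforce
next
  case (3 g i j)
  then show ?thesis using zigzag_edge.foot[of kind_of u v] place_nth by fastforce
next
  case (4 g i j)
  then show ?thesis using zigzag_edge.enter[of kind_of u v] place_nth by fastforce
next
  case (5 g i j l)
  then show ?thesis using zigzag_edge.up[of kind_of u _ _ _ v] by fastforce
next
  case (6 g i j l)
  then show ?thesis using zigzag_edge.down[of kind_of u _ _ _ v] by fastforce
next
  case (7 g i j)
  then show ?thesis using zigzag_edge.down[of kind_of u _ _ "N - 1" v] N_pos by fastforce
next
  case (8 g i j)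
  then show ?thesis using zigzag_edge.down[of kind_of u _ _ "N - 1" v] N_pos by fastforce
qed

lemma edges_iff: "{u, v} \<in> edges \<longleftrightarrow> link u v \<or> link v u"
  by (auto simp: edges_def doubleton_eq_iff)

lemma cost_zigzag_edge:
  assumes "{u, v} \<in> edges"
  shows "zigzag_edge kind_of N u v (cost {u, v}) \<or> zigzag_edge kind_of N v u (cost {u, v})"
proof -
  have "\<exists>d a b. {u, v} = {a, b} \<and> zigzag_edge kind_of N a b d"
    using assms link_zigzag_edge by (metis edges_iff insert_commute)
  then have "\<exists>a b. {u, v} = {a, b} \<and> zigzag_edge kind_of N a b (cost {u, v})"
    unfolding cost_def by (rule someI_ex)
  then show ?thesis by (auto simp: doubleton_eq_iff)
qed

lemma zigzag_edge_terminals: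
  assumes "zigzag_edge kind_of N u v d" "u < n" "v < n"
  shows "d = 1"
  using assms(1) kind_of_simps(1)[OF assms(2)] kind_of_simps(1)[OF assms(3)] by cases simp_all

lemma zigzag_edge_terminal_ge:
  assumes "zigzag_edge kind_of N u v d \<or> zigzag_edge kind_of N v u d" "u < n"
  shows "1 / 2 \<le> d"
  using assms(1)
proof
  assume "zigzag_edge kind_of N u v d"
  then show ?thesis using kind_of_simps(1)[OF assms(2)] foot_ge[of N] meet_ge[of N] by cases simp_all
next
  assume "zigzag_edge kind_of N v u d"
  then show ?thesis using kind_of_simps(1)[OF assms(2)] foot_ge[of N] meet_ge[of N] by cases simp_all
qed

lemma zigzag_edge_up:
  assumes "zigzag_edge kind_of N u v d \<or> zigzag_edge kind_of N v u d"
    and "kind_of u = Valley b x l" "kind_of v = Ridge b' x' l"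
  shows "d = 2 * gap N"
  using assms(1)
proof
  assume "zigzag_edge kind_of N u v d"
  then show ?thesis using assms(2,3) by cases simp_all
next
  assume "zigzag_edge kind_of N v u d"
  then show ?thesis using assms(2,3) by cases simp_all
qed

lemma zigzag_edge_down:
  assumes "zigzag_edge kind_of N u v d \<or> zigzag_edge kind_of N v u d"
    and "kind_of u = Ridge b x l" "kind_of v = Valley b' x' k" "k = Suc l"
  shows "d = gap N"
  using assms(1)
proof
  assume "zigzag_edge kind_of N u v d"
  then show ?thesis using assms(2-4) by cases simp_all
next
  assume "zigzag_edge kind_of N v u d"
  then show ?thesis using assms(2-4) by cases simp_all
qed

lemma zigzag_edge_pos:
  assumes "zigzag_edge kind N u v d"
  shows "0 < d"
  using assms gap_pos[OF N_pos] foot_ge[of N] meet_ge[of N]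
  by cases (auto intro: less_le_trans[of 0 "1 / 2"])

section \<open>The graph is a Steiner tree instance\<close>

lemma finite_vertices: "finite vertices"
proof -
  let ?G = "{g. set g \<subseteq> {..<n} \<and> length g = Suc K}"
  have "finite ?G" by (rule finite_lists_length_eq) simp
  then have fin: "finite (?G \<times> {..<K} \<times> {..2 * N} \<times> {..<N})" by simp
  have "vertices \<subseteq> {..<n} \<union> code ` ((\<lambda>(g, i, j, l). Low g i j l) ` (?G \<times> {..<K} \<times> {..2 * N} \<times> {..<N}) \<union>
      (\<lambda>(g, i, j, l). High g i j l) ` (?G \<times> {..<K} \<times> {..2 * N} \<times> {..<N}) \<union>
      (\<lambda>(g, i, j, l). Top g i j) ` (?G \<times> {..<K} \<times> {..2 * N} \<times> {..<N}))"
    using N_pos unfolding vertices_def by (force simp: place_def image_iff)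
  then show ?thesis using fin finite_subset by blast
qed

lemma graph_connected: "graph_connected vertices edges"
proof -
  have arc: "link u v \<Longrightarrow> (u, v) \<in> arcs edges \<and> (v, u) \<in> arcs edges" for u v
    by (simp add: arcs_def edges_iff)
  have to: "\<exists>x<n. (x, v) \<in> (arcs edges)\<^sup>* \<and> (v, x) \<in> (arcs edges)\<^sup>*" if "v \<in> vertices" for v
    using that
  proof (cases rule: vertices_cases)
    case (low g i j l)
    then show ?thesis using arc[OF link.intros(2)] place_nth(1) by blast
  next
    case (high g i j l)
    then show ?thesis using arc[OF link.intros(2)] arc[OF link.intros(5)] place_nth(1)
      by (meson converse_rtrancl_into_rtrancl r_into_rtrancl)
  next
    case (top g i j)
    then show ?thesis using arc[OF link.intros(3)] place_nth(1) by blast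
  qed auto
  have "(x, y) \<in> (arcs edges)\<^sup>*" if "x < n" "y < n" for x y
    using that arc[OF link.intros(1)] by (cases "x = y") auto
  then have "(u, v) \<in> (arcs edges)\<^sup>*" if "u \<in> vertices" "v \<in> vertices" for u v
    using to that by (meson rtrancl_trans)
  moreover have "e \<subseteq> vertices" if "e \<in> edges" for e
    using that link_vertices by (auto simp: edges_def)
  moreover have "0 \<in> vertices" using n_pos by (simp add: vertices_def)
  ultimately show ?thesis
    using rtrancl_arcs_path[of _ _ edges vertices] unfolding graph_connected_def by blast
qed

lemma steiner_instance: "steiner_instance vertices edges cost {..<n}"
proof -
  have "e \<subseteq> vertices \<and> card e = 2 \<and> 0 < cost e" if e: "e \<in> edges" for e
  proof -
    obtain u v where "e = {u, v}" "link u v" using e by (auto simp: edges_def)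
    moreover from this have "0 < cost e"
      using cost_zigzag_edge[of u v] e zigzag_edge_pos by auto
    ultimately show ?thesis using link_vertices by auto
  qed
  then show ?thesis
    using finite_vertices graph_connected n_pos
    by (auto simp: steiner_instance_def simple_graph_def vertices_def)
qed

section \<open>The random retraction\<close>

text \<open>
  The retraction sends all of a gadget to b with probability 1/2.  Otherwise the vertices with index i
  go to d_i or to a, depending on whether a random number is less than their height.
\<close>

definition height :: "node \<Rightarrow> nat" where
  "height x = (case x of
     Low g i j l \<Rightarrow> if j < 2 * N then min (3 * l) (2 * j + 1) else 6 * N - 3 * l
   | High g i j l \<Rightarrow> if j < 2 * N then min (3 * l + 2) (2 * j + 1) else 6 * N - 3 * l - 2
   | Top g i j \<Rightarrow> min (3 * N) (2 * j))"

definition pick :: "bool \<times> nat \<Rightarrow> nat list \<Rightarrow> nat \<Rightarrow> nat \<Rightarrow> nat" where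
  "pick \<omega> g i k = (if fst \<omega> then g ! 0 else if snd \<omega> < k then g ! (i + 2) else g ! 1)"

definition retraction :: "bool \<times> nat \<Rightarrow> nat \<Rightarrow> nat" where
  "retraction \<omega> v = (if v < n then v else case node_of v of
     Low g i j l \<Rightarrow> pick \<omega> g i (height (node_of v))
   | High g i j l \<Rightarrow> pick \<omega> g i (height (node_of v))
   | Top g i j \<Rightarrow> pick \<omega> g i (height (node_of v)))"

text \<open>A coin and a threshold, \<open>12 * N\<close> outcomes in all, so that the probability
  of a single outcome is \<open>gap N\<close>.\<close>

definition outcomes :: "(bool \<times> nat) set" where
  "outcomes = UNIV \<times> {..<6 * N}"

lemma card_outcomes: "card outcomes = 12 * N" "finite outcomes"
  by (simp_all add: outcomes_def card_cartesian_product card_UNIV_bool)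

lemma retraction_simps [simp]:
  "v < n \<Longrightarrow> retraction \<omega> v = v"
  "retraction \<omega> (code (Low g i j l)) = pick \<omega> g i (height (Low g i j l))"
  "retraction \<omega> (code (High g i j l)) = pick \<omega> g i (height (High g i j l))"
  "retraction \<omega> (code (Top g i j)) = pick \<omega> g i (height (Top g i j))"
  by (simp_all add: retraction_def)

text \<open>At height 0 nothing is sent to d_i, so the top shared by all \<open>i\<close> has a
  well-defined image.\<close>

lemma retraction_top [simp]: "retraction \<omega> (code (top_of g i j)) = pick \<omega> g i (height (Top g i j))"
  by (simp add: top_of_def pick_def height_def)

lemma card_pick:
  assumes "k \<le> k' + m" "k' \<le> k + m"
  shows "card {\<omega> \<in> outcomes. pick \<omega> g i k \<noteq> pick \<omega> g i k'} \<le> m"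
proof -
  have "{\<omega> \<in> outcomes. pick \<omega> g i k \<noteq> pick \<omega> g i k'} \<subseteq> Pair False ` {min k k'..<max k k'}"
    by (auto simp: pick_def image_iff split: if_splits)
  then have "card {\<omega> \<in> outcomes. pick \<omega> g i k \<noteq> pick \<omega> g i k'} \<le> card (Pair False ` {min k k'..<max k k'})"
    by (intro card_mono) auto
  also have "\<dots> \<le> card {min k k'..<max k k'}" by (intro card_image_le) simp
  also have "\<dots> \<le> m" using assms by auto
  finally show ?thesis .
qed

lemma card_half:
  assumes "\<And>q. q < 6 * N \<Longrightarrow> \<not> Q (s, q)"
  shows "card {\<omega> \<in> outcomes. Q \<omega>} \<le> 6 * N"
proof -
  have "{\<omega> \<in> outcomes. Q \<omega>} \<subseteq> Pair (\<not> s) ` {..<6 * N}"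
  proof
    fix \<omega> assume "\<omega> \<in> {\<omega> \<in> outcomes. Q \<omega>}"
    then obtain s' q where \<omega>: "\<omega> = (s', q)" "q < 6 * N" "Q (s', q)" by (auto simp: outcomes_def)
    then have "s' = (\<not> s)" using assms[of q] by (cases "s' = s") auto
    then show "\<omega> \<in> Pair (\<not> s) ` {..<6 * N}" using \<omega> by simp
  qed
  then have "card {\<omega> \<in> outcomes. Q \<omega>} \<le> card (Pair (\<not> s) ` {..<6 * N})"
    by (intro card_mono) auto
  also have "\<dots> \<le> card {..<6 * N}" by (intro card_image_le) simp
  finally show ?thesis by simp
qed

text \<open>Edges from a terminal into a gadget cost at least 1/2, and one side of the coin maps
  their ends to the same terminal. On the other edges heights differ by at most the cost in units of
  \<open>gap N\<close>, that is, 2 between valley and ridge of the same level and 1 otherwise.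
  Zigzag \<open>j\<close> of a is capped at \<open>2 * j + 1\<close>, between its tops of heights
  \<open>2 * j\<close> and \<open>2 * j + 2\<close> (both cut at \<open>3 * N\<close>). The zigzag
  of d_i falls from \<open>6 * N\<close> to \<open>3 * N + 1\<close> at its last ridge, next to the
  top \<open>j = 2 * N\<close>, whose height is \<open>3 * N\<close>.\<close>

lemma link_separate:
  assumes "link u v"
  shows "real (card {\<omega> \<in> outcomes. retraction \<omega> u \<noteq> retraction \<omega> v}) \<le> real (card outcomes) * cost {u, v}"
proof -
  let ?S = "{\<omega> \<in> outcomes. retraction \<omega> u \<noteq> retraction \<omega> v}"
  have z: "zigzag_edge kind_of N u v (cost {u, v}) \<or> zigzag_edge kind_of N v u (cost {u, v})"
    using assms by (intro cost_zigzag_edge) (simp add: edges_iff)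
  have half: ?thesis if "card ?S \<le> 6 * N" "1 / 2 \<le> cost {u, v}"
  proof -
    have "real (12 * N) * (1 / 2) \<le> real (12 * N) * cost {u, v}" using that by (intro mult_left_mono) auto
    then show ?thesis using that card_outcomes by simp
  qed
  have small: ?thesis if "card ?S \<le> m" "cost {u, v} = real m * gap N" for m
    using that card_outcomes N_pos by (simp add: gap_def)
  from assms show ?thesis
  proof cases
    case 1
    then have "cost {u, v} = 1"
      using z zigzag_edge_terminals[of u v] zigzag_edge_terminals[of v u] by metis
    moreover have "card ?S \<le> card outcomes" by (intro card_mono card_outcomes(2)) auto
    ultimately show ?thesis by simp
  next
    case (2 g i j l)
    have "retraction (True, q) u = retraction (True, q) v" for q
      using 2(1,2) place_nth(1)[OF 2(3)] by (simp add: pick_def)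
    then have half_card: "card ?S \<le> 6 * N" by (intro card_half[of _ True]) simp
    have ge: "1 / 2 \<le> cost {u, v}"
      using zigzag_edge_terminal_ge[OF z] place_nth(1)[OF 2(3)] 2(1) by simp
    show ?thesis by (rule half[OF half_card ge])
  next
    case (3 g i j)
    have "retraction (True, q) u = retraction (True, q) v" for q
      using 3(1,2) place_nth(1)[OF 3(3)] by (simp add: pick_def)
    then have half_card: "card ?S \<le> 6 * N" by (intro card_half[of _ True]) simp
    have ge: "1 / 2 \<le> cost {u, v}"
      using zigzag_edge_terminal_ge[OF z] place_nth(1)[OF 3(3)] 3(1) by simp
    show ?thesis by (rule half[OF half_card ge])
  next
    case (4 g i j)
    have "retraction (False, q) u = retraction (False, q) v" if "q < 6 * N" for q
      using 4(1,2) place_nth(2)[OF 4(3)] that by (simp add: pick_def height_def owner_def)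
    then have half_card: "card ?S \<le> 6 * N" by (intro card_half[of _ False]) simp
    have ge: "1 / 2 \<le> cost {u, v}"
      using zigzag_edge_terminal_ge[OF z] place_nth(2)[OF 4(3)] 4(1) by simp
    show ?thesis by (rule half[OF half_card ge])
  next
    case (5 g i j l)
    have "card ?S \<le> 2" unfolding 5 retraction_simps using 5(4) by (intro card_pick) (auto simp: height_def)
    moreover have "cost {u, v} = real 2 * gap N" using zigzag_edge_up[OF z] 5(1,2) by simp
    ultimately show ?thesis by (rule small)
  next
    case (6 g i j l)
    have "card ?S \<le> 1" unfolding 6 retraction_simps using 6(4) by (intro card_pick) (auto simp: height_def)
    moreover have "cost {u, v} = real 1 * gap N" using zigzag_edge_down[OF z] 6(1,2) by simp
    ultimately show ?thesis by (rule small)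
  next
    case (7 g i j)
    have "j \<le> 2 * N" using 7 by (simp add: place_def)
    then have "card ?S \<le> 1" unfolding 7 retraction_simps retraction_top using N_pos
      by (intro card_pick) (auto simp: height_def)
    moreover have "cost {u, v} = real 1 * gap N" 
      using zigzag_edge_down[OF z, of "g ! 0" "owner g i j" "N - 1" "g ! 0" "g ! 1" N] 7(1,2) N_pos by simp
    ultimately show ?thesis by (rule small)
  next
    case (8 g i j)
    have "card ?S \<le> 1" unfolding 8 retraction_simps retraction_top using N_pos 8(4)
      by (intro card_pick) (auto simp: height_def)
    moreover have "cost {u, v} = real 1 * gap N" 
      using zigzag_edge_down[OF z, of "g ! 0" "owner g i j" "N - 1" "g ! 0" "g ! 1" N] 8(1,2) N_pos by simp
    ultimately show ?thesis by (rule small)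
  qed
qed

lemma retraction_less:
  assumes "v \<in> vertices"
  shows "retraction \<omega> v < n"
proof -
  have "pick \<omega> g i k < n" if "place g i j" for g i j k
    using place_nth_less[OF that] that K_ge by (auto simp: pick_def place_def)
  with assms show ?thesis by (cases rule: vertices_cases) auto
qed

sublocale retractable vertices edges cost "{..<n}" outcomes retraction
proof
  show "steiner_instance vertices edges cost {..<n}" by (rule steiner_instance)
  show "{x, y} \<in> edges \<and> cost {x, y} = 1" if "x \<in> {..<n}" "y \<in> {..<n}" "x \<noteq> y" for x y
  proof -
    have e: "{x, y} \<in> edges" using that link.intros(1) by (simp add: edges_iff)
    have "x < n" "y < n" using that by simp_all
    then show ?thesis
      using e cost_zigzag_edge[OF e] zigzag_edge_terminals[of x y] zigzag_edge_terminals[of y x] by metis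
  qed
  show "finite outcomes" by (rule card_outcomes)
  have "(True, 0) \<in> outcomes" using N_pos by (simp add: outcomes_def)
  then show "outcomes \<noteq> {}" by blast
  show "retraction \<omega> x = x" if "x \<in> {..<n}" for \<omega> x using that by simp
  show "retraction \<omega> v \<in> {..<n}" if "v \<in> vertices" for \<omega> v using retraction_less that by simp
  show "real (card {\<omega> \<in> outcomes. retraction \<omega> u \<noteq> retraction \<omega> v}) \<le> real (card outcomes) * cost {u, v}"
    if "{u, v} \<in> edges" for u v
    using that link_separate[of u v] link_separate[of v u]
    by (auto simp: edges_iff insert_commute eq_commute[of "retraction _ u"])
qed

section \<open>The instances contain all gadgets\<close>

lemma zigzag:
  assumes "merge_plan {..<n} M"
  shows "zigzag vertices edges cost {..<n} M kind_of N K"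
proof
  show "steiner_instance vertices edges cost {..<n}" by (rule steiner_instance)
  show "merge_plan {..<n} M" by (rule assms)
  show "0 < N" "6 \<le> K" by (rule N_pos K_ge)+
  show "kind_of v = Terminal \<longleftrightarrow> v \<in> {..<n}" for v
    by (auto simp: kind_of_def split: node.splits)
  show "zigzag_edge kind_of N u v (cost {u, v}) \<or> zigzag_edge kind_of N v u (cost {u, v})"
    if "{u, v} \<in> edges" for u v using that by (rule cost_zigzag_edge)
  show "{x, y} \<in> edges" if "x \<in> {..<n}" "y \<in> {..<n}" "x \<noteq> y" for x y
    using that link.intros(1) by (simp add: edges_iff)
  show "b \<in> {..<n} \<and> b \<noteq> x \<and> l \<le> N \<and> {b, v} \<in> edges"
    if "v \<in> vertices" "kind_of v = Valley b x l" for v b x l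
    using that(1)
  proof (cases rule: vertices_cases)
    case (low g i j l')
    then show ?thesis using that(2) place_nth[OF low(2)] link.intros(2)[of g i j l'] by (simp add: edges_iff)
  next
    case (top g i j)
    have "{g ! 0, v} \<in> edges" using link.intros(3)[OF top(2)] top(1) by (simp add: edges_iff)
    moreover have "b = g ! 0" "x = g ! 1" "l = N" using that(2) top(1) by simp_all
    ultimately show ?thesis using place_nth[OF top(2)] by simp
  qed (use that in auto)
  show "x \<in> {..<n} \<and> l < N \<and> (\<exists>v. kind_of v = Valley b x l \<and> {v, w} \<in> edges \<and> (l = 0 \<longrightarrow> {x, v} \<in> edges) \<and>
        (\<forall>k. l = Suc k \<longrightarrow> (\<exists>w'. kind_of w' = Ridge b x k \<and> {w', v} \<in> edges)))"
    if "w \<in> vertices" "kind_of w = Ridge b x l" for w b x l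
    using that(1)
  proof (cases rule: vertices_cases)
    case (high g i j l')
    have eq: "b = g ! 0" "x = owner g i j" "l' = l" using high(1) that(2) by auto
    let ?v = "code (Low g i j l)"
    have "kind_of ?v = Valley b x l" using eq by simp
    moreover have "{?v, w} \<in> edges" using link.intros(5)[OF high(2,3)] high(1) eq(3) by (simp add: edges_iff)
    moreover have "{x, ?v} \<in> edges" if "l = 0"
      using link.intros(4)[OF high(2)] eq(2) that by (simp add: edges_iff)
    moreover have "kind_of (code (High g i j k)) = Ridge b x k \<and> {code (High g i j k), ?v} \<in> edges" if "l = Suc k" for k
      using link.intros(6)[OF high(2), of k] high(3) eq that by (simp add: edges_iff)
    moreover have "x < n" "l < N" using place_nth(2)[OF high(2)] high(3) eq by simp_all
    ultimately show ?thesis by blast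
  qed (use that in auto)
  show "\<exists>h x. kind_of h = Valley b x N \<and> (\<exists>w. kind_of w = Ridge b a (N - 1) \<and> {w, h} \<in> edges) \<and>
        (\<forall>d\<in>D. \<exists>w e x'. kind_of w = Ridge b d (N - 1) \<and> kind_of e = Valley b x' N \<and> {w, e} \<in> edges \<and>
          (e, h) \<in> (bridges kind_of N edges b a)\<^sup>*)"
    if D: "b \<in> {..<n}" "a \<in> {..<n}" "D \<subseteq> {..<n}" "b \<noteq> a" "b \<notin> D" "a \<notin> D" "Suc (card D) = K" for b a D
  proof -
    have "finite D" using finite_subset[OF D(3)] by simp
    then obtain ds where ds: "set ds = D" "distinct ds" using finite_distinct_list by blast
    define g where "g = b # a # ds"
    have len: "Suc (length ds) = K" using ds D(7) distinct_card[of ds] by simp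
    have pl: "place g i j" if "i < length ds" "j \<le> 2 * N" for i j
      using that ds D(1-6) len unfolding place_def g_def by (simp add: subset_eq)
    have ow: "owner g i j = a" if "j < 2 * N" for i j using that by (simp add: owner_def g_def)
    have g0: "g ! 0 = b" "g ! 1 = a" by (simp_all add: g_def)
    let ?h = "code (Top g 0 0)"
    have "0 < length ds" using len K_ge by linarith
    then have "{code (High g 0 0 (N - 1)), ?h} \<in> edges"
      using link.intros(7)[OF pl[of 0 0]] unfolding edges_iff by (simp add: top_of_def)
    moreover have "kind_of (code (High g 0 0 (N - 1))) = Ridge b a (N - 1)"
      using ow[of 0 0] N_pos g0 by simp
    ultimately have "\<exists>w. kind_of w = Ridge b a (N - 1) \<and> {w, ?h} \<in> edges" by blast
    moreover have "\<exists>w e x'. kind_of w = Ridge b d (N - 1) \<and> kind_of e = Valley b x' N \<and> {w, e} \<in> edges \<and>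
          (e, ?h) \<in> (bridges kind_of N edges b a)\<^sup>*" if d: "d \<in> D" for d
    proof -
      obtain i where i: "i < length ds" "ds ! i = d" using d ds(1) by (metis in_set_conv_nth)
      \<comment> \<open>The last ridge of zigzag \<open>j\<close> of \<open>a\<close> touches the
        tops \<open>j\<close> and \<open>j + 1\<close>. Counting \<open>j\<close> down from
        \<open>2 * N\<close>, where the zigzag of \<open>d\<close> ends, leads to the common
        top.\<close>
      have step: "(code (top_of g i (Suc j)), code (top_of g i j)) \<in> bridges kind_of N edges b a" if "j < 2 * N" for j
      proof -
        let ?w = "code (High g i j (N - 1))"
        have "kind_of ?w = Ridge b a (N - 1)" using ow[OF that] g0 by simp
        moreover have "{?w, code (top_of g i (Suc j))} \<in> edges" "{?w, code (top_of g i j)} \<in> edges"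
          using link.intros(7,8)[OF pl[OF i(1), of j]] that by (simp_all add: edges_iff)
        moreover have "kind_of (code (top_of g i k)) = Valley b a N" for k using g0 by simp
        ultimately show ?thesis unfolding bridges_def mem_Collect_eq prod.case by blast
      qed
      have "(code (top_of g i j), ?h) \<in> (bridges kind_of N edges b a)\<^sup>*" if "j \<le> 2 * N" for j
        using that
      proof (induction j)
        case 0
        show ?case by (simp add: top_of_def)
      next
        case (Suc j)
        then show ?case using converse_rtrancl_into_rtrancl[OF step[of j]] by simp
      qed
      moreover have "kind_of (code (High g i (2 * N) (N - 1))) = Ridge b d (N - 1)"
        using i g0 by (simp add: owner_def g_def)
      moreover have "{code (High g i (2 * N) (N - 1)), code (top_of g i (2 * N))} \<in> edges"
        using link.intros(7)[OF pl[OF i(1), of "2 * N"]] by (simp add: edges_iff)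
      moreover have "kind_of (code (top_of g i (2 * N))) = Valley b a N" using g0 by simp
      ultimately show ?thesis
        by (intro exI[of _ "code (High g i (2 * N) (N - 1))"] exI[of _ "code (top_of g i (2 * N))"] exI[of _ a]) simp
    qed
    moreover have "kind_of ?h = Valley b a N" using g0 by simp
    ultimately show ?thesis by (intro exI[of _ ?h] exI[of _ a]) simp
  qed
qed

lemma merge_plan_based_value:
  assumes "merge_plan_based vertices edges cost {..<n} y" "r < n"
  shows "dual_value vertices {..<n} r y \<le> real n * (7 / 12 + 2 * gap N + 1 / real K) + real K"
proof -
  obtain M t where M: "merge_plan {..<n} M" "moat_state vertices edges cost M t y"
    using assms(1) by (auto simp: merge_plan_based_def moat_growing_output_def)
  interpret zigzag vertices edges cost "{..<n}" M kind_of N K by (rule zigzag[OF M(1)])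
  show ?thesis using moat_state_value[OF M(2), of r] assms(2) by simp
qed

end

theorem theorem1p4:
  fixes \<epsilon> :: real
  assumes "0 < \<epsilon>"
  shows "\<exists>(V :: nat set) E c R.
           steiner_instance V E c R \<and> 2 \<le> card R \<and> mst_optimal V E c R \<and>
           (\<forall>r\<in>R. \<forall>y. dual_solution V E c y \<and> merge_plan_based V E c R y \<longrightarrow>
              dual_value V R r y \<le> (7 / 12 + \<epsilon>) * TMST V E c R)"
proof -
  \<comment> \<open>The budget: \<open>2 * gap N\<close> takes \<epsilon>/6 and
    \<open>1 / real K\<close> takes \<epsilon>/4. A further \<epsilon>/3 per unit of
    \<open>real n - 1\<close> absorbs the additive \<open>K\<close> and one extra \<open>?q\<close>,
    which is at most 2 and arises because the value bound has the factor \<open>n\<close> and TMST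
    is \<open>n - 1\<close>.\<close>
  obtain N :: nat where N: "0 < N" "1 / real N < \<epsilon>"
    using assms by (metis inverse_eq_divide reals_Archimedean of_nat_0_less_iff zero_less_Suc)
  obtain k :: nat where k: "4 / \<epsilon> < real k" using reals_Archimedean2 by blast
  define K where "K = k + 6"
  have K: "6 \<le> K" "1 / real K < \<epsilon> / 4"
    using k assms by (auto simp: K_def field_simps)
  obtain m :: nat where m: "(real K + 2) * 3 / \<epsilon> < real m" using reals_Archimedean2 by blast
  define n where "n = m + 2"
  have n: "2 \<le> n" "real K + 2 \<le> \<epsilon> / 3 * (real n - 1)"
    using m assms by (auto simp: n_def field_simps)
  interpret construction n N K using N(1) K(1) n(1) by unfold_locales auto
  have gap: "2 * gap N < \<epsilon> / 6" using N by (simp add: gap_def)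
  let ?q = "7 / 12 + 2 * gap N + 1 / real K"
  have q: "?q \<le> 7 / 12 + 5 / 12 * \<epsilon>" using gap K(2) by simp
  have q1: "?q \<le> 2"
  proof -
    have "1 / real K \<le> 1 / 6" using K(1) by (intro divide_left_mono) auto
    moreover have "gap N \<le> 1 / 12" using N(1) by (simp add: gap_def)
    ultimately show ?thesis by simp
  qed
  have bound: "real n * ?q + real K \<le> (7 / 12 + \<epsilon>) * (real n - 1)"
  proof -
    have "(real n - 1) * ?q \<le> (real n - 1) * (7 / 12 + 5 / 12 * \<epsilon>)"
      using q n(1) by (intro mult_left_mono) auto
    then have "(real n - 1) * ?q + (?q + real K) \<le> (real n - 1) * (7 / 12 + 5 / 12 * \<epsilon>) + \<epsilon> / 3 * (real n - 1)"
      using q1 n(2) by (intro add_mono) auto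
    moreover have "real n * ?q + real K = (real n - 1) * ?q + (?q + real K)"
      by (simp add: left_diff_distrib)
    ultimately have "real n * ?q + real K \<le> (real n - 1) * (7 / 12 + 5 / 12 * \<epsilon>) + \<epsilon> / 3 * (real n - 1)"
      by simp
    also have "\<dots> = (7 / 12 + 5 / 12 * \<epsilon> + \<epsilon> / 3) * (real n - 1)"
      by (simp only: distrib_right mult.commute[of "real n - 1"])
    also have "\<dots> \<le> (7 / 12 + \<epsilon>) * (real n - 1)"
      using assms n(1) by (intro mult_right_mono) auto
    finally show ?thesis .
  qed
  have "dual_value vertices {..<n} r y \<le> (7 / 12 + \<epsilon>) * TMST vertices edges cost {..<n}"
    if "r < n" "merge_plan_based vertices edges cost {..<n} y" for r y
    using merge_plan_based_value[OF that(2,1)] bound TMST_eq by simp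
  then show ?thesis
    using steiner_instance mst_optimal n(1)
    by (intro exI[of _ vertices] exI[of _ edges] exI[of _ cost] exI[of _ "{..<n}"]) auto
qed

end
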